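(* Let $d\ge 2$, $a \in \mathbb{R}^d$ with $a\neq 0$, $\Sigma_X,\Sigma_Y$ be positive definite $d\times d$ matrices, and $\mathcal{L}_1,\mathcal{L}_2$ be cdfs on $\mathbb{R}$, all known. For unknown $\theta\in\mathbb{R}^d$, let $X|\theta \sim MMN_d(\theta, a, \Sigma_X, \mathcal{L}_1)$ and $Y|\theta \sim MMN_d(\theta, a, \Sigma_Y, \mathcal{L}_2)$ be independently distributed. Then the Kullback-Leibler risk of the minimum risk equivariant (MRE) predictive density $\hat{q}_U$ is given by $$ R_{KL}(\theta,\hat{q}_U) = H_1\left(\sqrt{a^\top \Sigma_S^{-1} a}, 1, \mathcal{L}_3\right) - H_1\left(\sqrt{a^\top \Sigma_Y^{-1} a}, 1, \mathcal{L}_2\right) + \frac{1}{2}\log\frac{|\Sigma_S|}{|\Sigma_Y|}, $$ with $\Sigma_S = \Sigma_X + \Sigma_Y$ and $\mathcal{L}_3$ the cdf of $V_2 - V_1$, where $V_1\sim\mathcal{L}_1$ and $V_2\sim\mathcal{L}_2$ are independent.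
   Context: A random vector $X \in \mathbb{R}^d$ has a mean-mixture of normal distributions, written $X \sim MMN_d(\theta, a, \Sigma, \mathcal{L})$, if $X|V=v \sim N_d(\theta + v a, \Sigma)$ with $V \sim \mathcal{L}$, where $\theta\in\mathbb{R}^d$ is a location parameter, $a \in \mathbb{R}^d$ a perturbation vector, $\Sigma$ a positive definite matrix, and $V$ a scalar random variable with cdf $\mathcal{L}$. The entropy of a Lebesgue density $f$ on $\mathbb{R}^d$ is $H(f) = -\int_{\mathbb{R}^d} f(t)\log f(t)\,dt$, and $H_d(b,\Sigma,\mathcal{L})$ denotes the entropy of the $MMN_d(0,b,\Sigma,\mathcal{L})$ density (so $H_1(b,1,\mathcal{L})$ is the entropy of the univariate $MMN_1(0,b,1,\mathcal{L})$ density). $|\Sigma|$ denotes the determinant. The MRE predictive density $\hat{q}_U(\cdot;X)$ for the density of $Y$ is the Bayes predictive density for the uniform prior $\pi_U(\theta)=1$ on $\mathbb{R}^d$, i.e., the density of $MMN_d(X, a, \Sigma_X+\Sigma_Y, \mathcal{L}_3)$. With $p(\cdot|\theta)$ and $q(\cdot|\theta)$ the densities of $X$ and $Y$ given $\theta$, the Kullback-Leibler risk is $R_{KL}(\theta,\hat{q}) = \int_{\mathbb{R}^d} \left\{ \int_{\mathbb{R}^d} q(y|\theta) \log \frac{q(y|\theta)}{\hat{q}(y;x)}\, dy \right\} p(x|\theta)\, dx$.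
   Formalization: It is additionally assumed that the two univariate entropies H_1(·,1,L_3) and H_1(·,1,L_2) are not both +∞; for some heavy-tailed cdfs both are infinite and the right-hand side would be the undefined ∞ − ∞. *)

theory Defs
  imports "HOL-Probability.Probability"
begin

definition pos_def_matrix :: "real ^ 'n ^ 'n \<Rightarrow> bool" where
  "pos_def_matrix A \<longleftrightarrow> transpose A = A \<and> (\<forall>x. x \<noteq> 0 \<longrightarrow> 0 < x \<bullet> (A *v x))"

definition mvn_density :: "real ^ 'n \<Rightarrow> real ^ 'n ^ 'n \<Rightarrow> real ^ 'n \<Rightarrow> real" where
  "mvn_density \<mu> \<Sigma> x =
     exp (- ((x - \<mu>) \<bullet> (matrix_inv \<Sigma> *v (x - \<mu>))) / 2) / sqrt ((2 * pi) ^ CARD('n) * det \<Sigma>)"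

(* Lebesgue density of the law of X, where X | V = v is N(theta + v a, Sigma) and V has
   cdf L; interval_measure L is the Lebesgue-Stieltjes measure of L.  That this is a
   density of the mixture is lemma emeasure_mmn_density below. *)
definition mmn_density ::
    "real ^ 'n \<Rightarrow> real ^ 'n \<Rightarrow> real ^ 'n ^ 'n \<Rightarrow> (real \<Rightarrow> real) \<Rightarrow> real ^ 'n \<Rightarrow> real" where
  "mmn_density \<theta> a \<Sigma> L t = (\<integral>v. mvn_density (\<theta> + v *\<^sub>R a) \<Sigma> t \<partial>interval_measure L)"

(* Integral of an extended-real function as the difference of the integrals of its positive
   and negative parts.  The Bochner integral is 0 on non-integrable functions and so cannot
   express infinite entropies and risks.  Pitfall: in ereal, infinity - infinity = infinity. *)
definition ext_integral :: "'a measure \<Rightarrow> ('a \<Rightarrow> ereal) \<Rightarrow> ereal" where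
  "ext_integral M f =
     enn2ereal (\<integral>\<^sup>+x. e2ennreal (f x) \<partial>M) - enn2ereal (\<integral>\<^sup>+x. e2ennreal (- f x) \<partial>M)"

definition diff_entropy :: "(real ^ 'n \<Rightarrow> real) \<Rightarrow> ereal" where
  "diff_entropy f = - ext_integral lborel (\<lambda>t. ereal (f t * ln (f t)))"

definition mmn_entropy :: "real ^ 'n \<Rightarrow> real ^ 'n ^ 'n \<Rightarrow> (real \<Rightarrow> real) \<Rightarrow> ereal" where
  "mmn_entropy b \<Sigma> L = diff_entropy (mmn_density 0 b \<Sigma> L)"

(* The univariate case, for MMN_1(0, b, s, L), as the instance of dimension 1. *)
definition mmn_entropy1 :: "real \<Rightarrow> real \<Rightarrow> (real \<Rightarrow> real) \<Rightarrow> ereal" where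
  "mmn_entropy1 b s L = mmn_entropy (vec b :: real ^ 1) (mat s) L"

(* Models p, q take the parameter first: p theta x, q theta y.  A predictive density r
   takes the future value first: r y x stands for r(y; x). *)
definition bayes_predictive ::
    "(real ^ 'n \<Rightarrow> real) \<Rightarrow> (real ^ 'n \<Rightarrow> real ^ 'n \<Rightarrow> real) \<Rightarrow> (real ^ 'n \<Rightarrow> real ^ 'n \<Rightarrow> real)
      \<Rightarrow> real ^ 'n \<Rightarrow> real ^ 'n \<Rightarrow> real" where
  "bayes_predictive \<pi> p q y x =
     (\<integral>\<theta>. q \<theta> y * (p \<theta> x * \<pi> \<theta>) \<partial>lborel) / (\<integral>\<theta>. p \<theta> x * \<pi> \<theta> \<partial>lborel)"

(* The minimum risk equivariant predictive density is the Bayes predictive density for the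
   uniform prior. *)
definition mre_predictive ::
    "(real ^ 'n \<Rightarrow> real ^ 'n \<Rightarrow> real) \<Rightarrow> (real ^ 'n \<Rightarrow> real ^ 'n \<Rightarrow> real)
      \<Rightarrow> real ^ 'n \<Rightarrow> real ^ 'n \<Rightarrow> real" where
  "mre_predictive p q = bayes_predictive (\<lambda>\<theta>. 1) p q"

definition KL_risk ::
    "(real ^ 'n \<Rightarrow> real ^ 'n \<Rightarrow> real) \<Rightarrow> (real ^ 'n \<Rightarrow> real ^ 'n \<Rightarrow> real)
      \<Rightarrow> real ^ 'n \<Rightarrow> (real ^ 'n \<Rightarrow> real ^ 'n \<Rightarrow> real) \<Rightarrow> ereal" where
  "KL_risk p q \<theta> r =
     ext_integral lborel (\<lambda>x.
       ext_integral lborel (\<lambda>y. ereal (q \<theta> y * ln (q \<theta> y / r y x))) * ereal (p \<theta> x))"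


lemma pos_def_matrix_invertible:
  fixes A :: "real ^ 'n ^ 'n"
  assumes "pos_def_matrix A"
  shows "invertible A"
proof -
  have "x = 0" if "A *v x = 0" for x
    using assms that unfolding pos_def_matrix_def by force
  then show ?thesis
    using invertible_left_inverse matrix_left_invertible_ker by blast
qed

lemma pos_def_matrix_det_pos:
  fixes A :: "real ^ 'n ^ 'n"
  assumes A: "pos_def_matrix A"
  shows "0 < det A"
proof (rule ccontr)
  assume "\<not> 0 < det A"
  define B where "B t = (1 - t) *\<^sub>R mat 1 + t *\<^sub>R A" for t :: real
  have "continuous_on {0..1} (\<lambda>t. det (B t))"
    unfolding B_def det_def by (intro continuous_intros)
  moreover have "det (B 0) = 1" "det (B 1) \<le> 0"
    using \<open>\<not> 0 < det A\<close> by (simp_all add: B_def)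
  ultimately obtain t where t: "0 \<le> t" "t \<le> 1" "det (B t) = 0"
    using IVT2'[of "\<lambda>t. det (B t)" 1 0 0] by auto
  have "pos_def_matrix (B t)"
    unfolding pos_def_matrix_def
  proof (intro conjI allI impI)
    show "transpose (B t) = B t"
      using A by (simp add: pos_def_matrix_def B_def vec_eq_iff transpose_def mat_def)
  next
    fix x :: "real ^ 'n" assume "x \<noteq> 0"
    have "x \<bullet> (B t *v x) = (1 - t) * (x \<bullet> x) + t * (x \<bullet> (A *v x))"
      by (simp add: B_def matrix_vector_mult_add_rdistrib inner_right_distrib
            flip: scaleR_matrix_vector_assoc)
    moreover have "0 < x \<bullet> x" "0 < x \<bullet> (A *v x)"
      using A \<open>x \<noteq> 0\<close> by (auto simp: pos_def_matrix_def)
    ultimately show "0 < x \<bullet> (B t *v x)"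
      using t by (cases "t = 0") (auto intro!: add_nonneg_pos)
  qed
  then show False
    using pos_def_matrix_invertible invertible_det_nz t(3) by blast
qed

lemma pos_def_matrix_inv_nonneg:
  fixes A :: "real ^ 'n ^ 'n"
  assumes "pos_def_matrix A"
  shows "0 \<le> x \<bullet> (matrix_inv A *v x)"
proof -
  define y where "y = matrix_inv A *v x"
  have "A *v y = x"
    unfolding y_def using pos_def_matrix_invertible[OF assms]
    by (simp add: matrix_inv_def invertible_def matrix_vector_mul_assoc)
      (metis (mono_tags, lifting) matrix_vector_mul_lid someI_ex)
  moreover have "0 \<le> y \<bullet> (A *v y)"
    using assms unfolding pos_def_matrix_def by (cases "y = 0") (auto intro: less_imp_le)
  ultimately show ?thesis
    by (simp add: y_def inner_commute)
qed

lemma measurable_mvn_density [measurable]: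
  "(\<lambda>(v, t). mvn_density (\<theta> + v *\<^sub>R a) \<Sigma> t) \<in> borel_measurable (borel \<Otimes>\<^sub>M borel)"
  unfolding mvn_density_def borel_prod case_prod_beta divide_inverse
  by (intro borel_measurable_continuous_onI continuous_intros
        matrix_vector_mult_linear_continuous_on[THEN continuous_on_compose2]) auto

lemma interval_measure_cdf:
  assumes "real_distribution M"
  shows "interval_measure (cdf M) = M"
proof -
  interpret M: real_distribution M by fact
  show ?thesis
    using assms
    by (intro cdf_unique real_distribution_interval_measure cdf_interval_measure
          M.cdf_nondecreasing M.cdf_is_right_cont M.cdf_lim_at_top_prob M.cdf_lim_at_bot)
qed

lemma emeasure_mmn_density:
  fixes \<Sigma> :: "real ^ 'n ^ 'n"
  assumes M: "real_distribution M" and \<Sigma>: "pos_def_matrix \<Sigma>" and A [measurable]: "A \<in> sets borel"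
  shows "emeasure (density lborel (mmn_density \<theta> a \<Sigma> (cdf M))) A =
         (\<integral>\<^sup>+v. emeasure (density lborel (mvn_density (\<theta> + v *\<^sub>R a) \<Sigma>)) A \<partial>M)"
proof -
  interpret M: real_distribution M by fact
  interpret P: pair_sigma_finite M lborel ..
  let ?f = "\<lambda>v. mvn_density (\<theta> + v *\<^sub>R a) \<Sigma>"
  define C where "C = 1 / sqrt \<bar>(2 * pi) ^ CARD('n) * det \<Sigma>\<bar>"
  have det: "0 \<le> det \<Sigma>"
    using pos_def_matrix_det_pos[OF \<Sigma>] by simp
  have bound: "\<bar>?f v t\<bar> \<le> C" and nonneg: "0 \<le> ?f v t" for v t
    using det pos_def_matrix_inv_nonneg[OF \<Sigma>]
    by (auto simp: mvn_density_def C_def abs_mult intro!: divide_right_mono)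
  have meas [measurable]: "(\<lambda>(v, t). ?f v t) \<in> borel_measurable (M \<Otimes>\<^sub>M borel)"
    using measurable_mvn_density[of \<theta> a \<Sigma>] by simp
  have int: "integrable M (\<lambda>v. ?f v t)" for t
    using bound by (intro M.integrable_const_bound[where B = C]) auto
  have mix: "ennreal (mmn_density \<theta> a \<Sigma> (cdf M) t) = (\<integral>\<^sup>+v. ennreal (?f v t) \<partial>M)" for t
    unfolding mmn_density_def interval_measure_cdf[OF M]
    using nonneg by (intro nn_integral_eq_integral[symmetric] int) auto
  have "(\<lambda>t. \<integral>\<^sup>+v. ennreal (?f v t) \<partial>M) \<in> borel_measurable borel"
    by measurable
  then have "emeasure (density lborel (mmn_density \<theta> a \<Sigma> (cdf M))) A =
      (\<integral>\<^sup>+t. (\<integral>\<^sup>+v. ennreal (?f v t) * indicator A t \<partial>M) \<partial>lborel)"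
    unfolding mix by (subst emeasure_density) (auto simp: nn_integral_multc)
  also have "\<dots> = (\<integral>\<^sup>+v. (\<integral>\<^sup>+t. ennreal (?f v t) * indicator A t \<partial>lborel) \<partial>M)"
    by (rule P.Fubini') measurable
  also have "\<dots> = (\<integral>\<^sup>+v. emeasure (density lborel (?f v)) A \<partial>M)"
    by (subst emeasure_density) auto
  finally show ?thesis .
qed

end

theory Submission
  imports Defs
begin

text \<open>
  The risk is a difference of two entropies, and the entropy of a mean-mixture of normals reduces to
  that of a univariate one.

  Both models are location families, with \<open>P\<close> and \<open>Q\<close> the densities at location \<open>0\<close>.
  Under the uniform prior the Bayes predictive density of a location family is \<open>G (y - x)\<close>, where
  \<open>G\<close> is the density of the difference \<open>Y - X\<close>, which does not depend on the location.
  Therefore the risk is \<open>E ln (Q (Y - \<theta>)) - E ln (G (Y - X))\<close>; both expectations are negative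
  entropies of densities, and the risk is the entropy of \<open>G\<close> minus the entropy of \<open>Q\<close>
  (lemmas \<open>mre_predictive_location_family\<close> and \<open>KL_risk_location_family\<close>).  A difference of two
  normal vectors is normal with the covariance matrices added, so that \<open>G\<close> is again a
  mean-mixture, with matrix \<open>\<Sigma>X + \<Sigma>Y\<close> and the law of \<open>V2 - V1\<close> as mixing law
  (\<open>nn_integral_mmn_density_convolution\<close>).

  For the entropy of a mean-mixture of normals, a matrix \<open>B\<close> whose columns are
  orthonormal for the inner product given by the inverse of \<open>\<Sigma>\<close>, one of them a multiple of \<open>a\<close>,
  transforms the mixture into a product: one coordinate carries a univariate mean-mixture, the
  others are independent standard normal.  Entropy is additive over products and changes by
  \<open>ln \<bar>det B\<bar>\<close> under the transformation, hence the \<open>d\<close>-dimensional entropy is the univariate one plus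
  a constant that depends on the dimension and \<open>det \<Sigma>\<close> alone (\<open>mmn_entropy_reduction\<close>).  In the
  difference of the two entropies, only the determinants survive of these constants.

  Entropies may be infinite.  All densities involved are bounded, and for \<open>f \<le> C\<close> the integrand
  \<open>f ln (C / f)\<close> is nonnegative; working with its integral \<open>scaled_entropy f C\<close> instead of the
  entropy keeps the whole calculation in the extended nonnegative reals, where additivity and the
  exchange of integrals hold without integrability conditions.  In this form the risk plus the scaled
  entropy of \<open>Q\<close> equals that of \<open>G\<close>.  The risk is nonnegative by Gibbs' inequality, which shows that
  an infinite entropy of \<open>Q\<close> forces an infinite entropy of \<open>G\<close>, the case that the
  assumption on the two entropies excludes.
\<close>

section \<open>Positive definite matrices and whitening\<close>

lemma invertible_matrix_inv:
  fixes A :: "real ^ 'n ^ 'n"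
  assumes "invertible A"
  shows "A ** matrix_inv A = mat 1" "matrix_inv A ** A = mat 1"
  using assms unfolding invertible_def matrix_inv_def by (metis (mono_tags, lifting) someI_ex)+

lemma pos_def_matrix_symmetric_form:
  assumes "pos_def_matrix A"
  shows "x \<bullet> (A *v y) = y \<bullet> (A *v x)"
  using assms unfolding pos_def_matrix_def
  by (metis dot_lmul_matrix inner_commute transpose_matrix_vector)

lemma pos_def_matrix_add:
  "pos_def_matrix A \<Longrightarrow> pos_def_matrix B \<Longrightarrow> pos_def_matrix (A + B)"
  unfolding pos_def_matrix_def
  by (auto simp: matrix_vector_mult_add_rdistrib inner_add_right add_pos_pos transpose_def vec_eq_iff)

lemma pos_def_matrix_inverse:
  fixes A :: "real ^ 'n ^ 'n"
  assumes A: "pos_def_matrix A"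
  shows "pos_def_matrix (matrix_inv A)"
proof -
  note inv = invertible_matrix_inv[OF pos_def_matrix_invertible[OF A]]
  have "transpose (matrix_inv A) ** A = transpose (A ** matrix_inv A)"
    using A by (simp add: matrix_transpose_mul pos_def_matrix_def)
  then have left: "transpose (matrix_inv A) ** A = mat 1"
    by (simp add: inv transpose_mat)
  have "transpose (matrix_inv A) = transpose (matrix_inv A) ** (A ** matrix_inv A)"
    by (simp add: inv)
  also have "\<dots> = matrix_inv A"
    by (simp add: matrix_mul_assoc left)
  finally have sym: "transpose (matrix_inv A) = matrix_inv A" .
  have "0 < x \<bullet> (matrix_inv A *v x)" if "x \<noteq> 0" for x
  proof -
    define y where "y = matrix_inv A *v x"
    have x: "x = A *v y" by (simp add: y_def matrix_vector_mul_assoc inv)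
    then have "y \<noteq> 0" using that by auto
    moreover have "x \<bullet> (matrix_inv A *v x) = y \<bullet> (A *v y)"
      by (metis x y_def inner_commute)
    ultimately show ?thesis using A by (simp add: pos_def_matrix_def)
  qed
  with sym show ?thesis by (auto simp: pos_def_matrix_def)
qed

lemma det_matrix_inv:
  fixes A :: "real ^ 'n ^ 'n"
  assumes "invertible A"
  shows "det (matrix_inv A) = 1 / det A"
proof -
  have "det A * det (matrix_inv A) = 1"
    using invertible_matrix_inv(1)[OF assms] det_mul[of A "matrix_inv A"] by simp
  then show ?thesis by (metis mult_zero_left nonzero_eq_divide_eq mult.commute zero_neq_one)
qed

text \<open>
  Gram-Schmidt for the inner product \<open>x \<bullet> (A *v y)\<close>, started at a prescribed unit vector \<open>u\<close>.  As
  long as fewer than \<open>CARD('n)\<close> vectors have been chosen, their images under \<open>A\<close> span a proper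
  subspace; a vector that is orthogonal to it in the usual sense is conjugate to all of them.
\<close>
lemma conjugate_set_exists:
  fixes A :: "real ^ 'n ^ 'n"
  assumes A: "pos_def_matrix A" and u: "u \<bullet> (A *v u) = 1" and "Suc k \<le> CARD('n)"
  shows "\<exists>S. finite S \<and> card S = Suc k \<and> u \<in> S \<and>
    (\<forall>x\<in>S. \<forall>y\<in>S. x \<bullet> (A *v y) = (if x = y then 1 else 0))"
  using assms(3)
proof (induction k)
  case 0
  show ?case by (rule exI[of _ "{u}"]) (use u in auto)
next
  case (Suc k)
  then obtain S where S: "finite S" "card S = Suc k" "u \<in> S"
    and orth: "\<And>x y. x \<in> S \<Longrightarrow> y \<in> S \<Longrightarrow> x \<bullet> (A *v y) = (if x = y then 1 else 0)"
    by auto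
  have "dim ((*v) A ` S) \<le> card ((*v) A ` S)"
    using S(1) by (intro dim_le_card') auto
  also have "\<dots> < DIM(real ^ 'n)"
    using card_image_le[OF S(1), of "(*v) A"] S(2) Suc.prems by simp
  finally obtain w where w: "w \<noteq> 0" "\<And>y. y \<in> span ((*v) A ` S) \<Longrightarrow> orthogonal w y"
    using orthogonal_to_subspace_exists by blast
  have wA: "w \<bullet> (A *v y) = 0" "y \<bullet> (A *v w) = 0" if "y \<in> S" for y
    using w(2)[of "A *v y"] that pos_def_matrix_symmetric_form[OF A, of y w]
    by (auto simp: orthogonal_def span_base)
  have pos: "0 < w \<bullet> (A *v w)" using A w(1) by (auto simp: pos_def_matrix_def)
  define z where "z = (1 / sqrt (w \<bullet> (A *v w))) *\<^sub>R w"
  have zz: "z \<bullet> (A *v z) = 1"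
    using pos by (simp add: z_def matrix_vector_mult_scaleR real_sqrt_mult_self flip: power2_eq_square)
  have zy: "z \<bullet> (A *v y) = 0" "y \<bullet> (A *v z) = 0" if "y \<in> S" for y
    using wA[OF that] by (simp_all add: z_def matrix_vector_mult_scaleR)
  have "z \<notin> S" using zz zy by force
  show ?case
    by (rule exI[of _ "insert z S"]) (use S orth zz zy \<open>z \<notin> S\<close> in auto)
qed

text \<open>
  Coordinates in which \<open>\<Sigma>\<close> becomes the identity and the perturbation vector \<open>a\<close> points along the
  coordinate axis \<open>k\<close>.  The columns of \<open>B\<close> form a basis that is orthonormal with respect to the
  inverse of \<open>\<Sigma>\<close>.
\<close>
lemma whitening_matrix_exists:
  fixes \<Sigma> :: "real ^ 'n ^ 'n"
  assumes \<Sigma>: "pos_def_matrix \<Sigma>" and a: "a \<noteq> 0"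
  obtains B :: "real ^ 'n ^ 'n"
  where "\<And>x. (B *v x) \<bullet> (matrix_inv \<Sigma> *v (B *v x)) = x \<bullet> x"
    "B *v axis k (sqrt (a \<bullet> (matrix_inv \<Sigma> *v a))) = a"
    "\<bar>det B\<bar> = sqrt (det \<Sigma>)" "det B \<noteq> 0"
proof -
  let ?A = "matrix_inv \<Sigma>"
  note A = pos_def_matrix_inverse[OF \<Sigma>]
  define c where "c = sqrt (a \<bullet> (?A *v a))"
  have aa: "0 < a \<bullet> (?A *v a)" using A a by (auto simp: pos_def_matrix_def)
  then have c: "0 < c" "c * c = a \<bullet> (?A *v a)" by (auto simp: c_def)
  define u where "u = (1 / c) *\<^sub>R a"
  have "u \<bullet> (?A *v u) = 1"
    using c by (simp add: u_def matrix_vector_mult_scaleR field_simps flip: c(2))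
  then obtain S where S: "finite S" "card S = CARD('n)" "u \<in> S"
    and orth: "\<And>x y. x \<in> S \<Longrightarrow> y \<in> S \<Longrightarrow> x \<bullet> (?A *v y) = (if x = y then 1 else 0)"
    using conjugate_set_exists[OF A, of u "CARD('n) - 1"] by auto
  obtain g where g: "bij_betw g (UNIV :: 'n set) S"
    using finite_same_card_bij[of "UNIV :: 'n set" S] S by auto
  \<comment> \<open>The transposition moves the normalised vector \<open>a\<close> to the position \<open>k\<close>.\<close>
  define f where "f = g \<circ> Transposition.transpose k (inv_into UNIV g u)"
  have f: "bij_betw f UNIV S"
    unfolding f_def by (rule bij_betw_trans[OF bij_transpose g])
  have fk: "f k = u"
    using g S(3) by (simp add: f_def f_inv_into_f bij_betw_def)
  have fi: "f i \<in> S" "f i = f j \<longleftrightarrow> i = j" for i j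
    using f by (auto simp: bij_betw_def inj_on_def)
  define B :: "real ^ 'n ^ 'n" where "B = (\<chi> i j. f j $ i)"
  have colB: "column j B = f j" for j by (simp add: B_def column_def vec_eq_iff)
  have gram: "transpose B ** ?A ** B = mat 1"
  proof -
    have "(transpose B ** ?A ** B) $ i $ j = (mat 1 :: real ^ 'n ^ 'n) $ i $ j" for i j
    proof -
      have "(transpose B ** (?A ** B)) $ i $ j = column i B \<bullet> column j (?A ** B)"
        by (simp add: matrix_matrix_mult_def transpose_def column_def inner_vec_def)
      also have "column j (?A ** B) = ?A *v column j B"
        by (simp add: matrix_matrix_mult_def column_def matrix_vector_mult_def vec_eq_iff)
      finally show ?thesis
        by (simp add: colB orth fi mat_def matrix_mul_assoc)
    qed
    then show ?thesis by (simp add: vec_eq_iff)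
  qed
  have 1: "(B *v x) \<bullet> (?A *v (B *v x)) = x \<bullet> x" for x
  proof -
    have "(B *v x) \<bullet> (?A *v (B *v x)) = x \<bullet> (transpose B *v (?A *v (B *v x)))"
      by (metis dot_lmul_matrix inner_commute transpose_matrix_vector)
    also have "\<dots> = x \<bullet> ((transpose B ** ?A ** B) *v x)"
      by (simp only: matrix_vector_mul_assoc matrix_mul_assoc)
    finally show ?thesis by (simp add: gram)
  qed
  have "axis k c = c *\<^sub>R (axis k 1 :: real ^ 'n)"
    by (simp add: axis_def vec_eq_iff)
  then have "B *v axis k c = c *\<^sub>R (B *v axis k 1)"
    by (simp only: matrix_vector_mult_scaleR)
  also have "\<dots> = a"
    using c by (simp add: matrix_vector_mult_basis colB fk u_def)
  finally have 2: "B *v axis k c = a" .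
  have "det B * det ?A * det B = 1"
    using arg_cong[OF gram, of det] by (simp add: det_mul)
  then have dB: "det B * det B = det \<Sigma>"
    using pos_def_matrix_det_pos[OF \<Sigma>]
    by (simp add: det_matrix_inv[OF pos_def_matrix_invertible[OF \<Sigma>]] field_simps)
  show thesis
    by (rule that[of B])
      (use 1 2 dB pos_def_matrix_det_pos[OF \<Sigma>] in \<open>auto simp: c_def simp flip: dB\<close>)
qed

section \<open>Linear change of variables\<close>

lemma Basis_vec_eq: "(Basis :: (real ^ 'n) set) = (\<lambda>i. axis i 1) ` UNIV"
  by (auto simp: Basis_vec_def)

lemma inj_axis: "inj (\<lambda>i. axis i (1::real) :: real ^ 'n)"
  by (auto simp: inj_on_def axis_eq_axis)

text \<open>
  Fubini's theorem for a single coordinate \<open>b\<close> against all the others.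
\<close>
lemma nn_integral_lborel_split_Basis:
  fixes g :: "'a::euclidean_space \<Rightarrow> ennreal"
  assumes b: "b \<in> Basis" and [measurable]: "g \<in> borel_measurable borel"
  shows "(\<integral>\<^sup>+v. g v \<partial>lborel) =
    (\<integral>\<^sup>+x. (\<integral>\<^sup>+y. g (y *\<^sub>R b + (\<Sum>e\<in>Basis - {b}. x e *\<^sub>R e)) \<partial>lborel) \<partial>Pi\<^sub>M (Basis - {b}) (\<lambda>_. lborel))"
proof -
  interpret product_sigma_finite "\<lambda>_ :: 'a. lborel :: real measure" ..
  have Basis: "insert b (Basis - {b}) = Basis" using b by auto
  have "(\<integral>\<^sup>+v. g v \<partial>lborel) =
      (\<integral>\<^sup>+x. g (\<Sum>e\<in>Basis. x e *\<^sub>R e) \<partial>Pi\<^sub>M (insert b (Basis - {b})) (\<lambda>_. lborel))"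
    unfolding Basis by (subst lborel_eq) (simp add: nn_integral_distr)
  also have "\<dots> = (\<integral>\<^sup>+x. (\<integral>\<^sup>+y. g (\<Sum>e\<in>Basis. (x(b := y)) e *\<^sub>R e) \<partial>lborel)
      \<partial>Pi\<^sub>M (Basis - {b}) (\<lambda>_. lborel))"
    by (rule product_nn_integral_insert) (auto simp: Basis)
  finally have split: "(\<integral>\<^sup>+v. g v \<partial>lborel) =
      (\<integral>\<^sup>+x. (\<integral>\<^sup>+y. g (\<Sum>e\<in>Basis. (x(b := y)) e *\<^sub>R e) \<partial>lborel)
      \<partial>Pi\<^sub>M (Basis - {b}) (\<lambda>_. lborel))" .
  have "(\<Sum>e\<in>Basis. (x(b := y)) e *\<^sub>R e) = y *\<^sub>R b + (\<Sum>e\<in>Basis - {b}. x e *\<^sub>R e)" for x y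
    using b by (subst sum.remove[of _ b]) (auto intro!: sum.cong)
  with split show ?thesis by simp
qed

text \<open>
  A shear translates every line in direction \<open>b\<close> by an amount that is constant on that line, because
  \<open>c\<close> is orthogonal to \<open>b\<close>.  So the innermost integral in the coordinate \<open>b\<close> does not change.
\<close>
lemma nn_integral_lborel_shear:
  fixes g :: "'a::euclidean_space \<Rightarrow> ennreal"
  assumes b: "b \<in> Basis" and c: "c \<bullet> b = 0" and [measurable]: "g \<in> borel_measurable borel"
  shows "(\<integral>\<^sup>+v. g (v + (v \<bullet> c) *\<^sub>R b) \<partial>lborel) = (\<integral>\<^sup>+v. g v \<partial>lborel)"
proof -
  have "(\<integral>\<^sup>+y. g (y *\<^sub>R b + w + ((y *\<^sub>R b + w) \<bullet> c) *\<^sub>R b) \<partial>lborel)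
      = (\<integral>\<^sup>+y. g (y *\<^sub>R b + w) \<partial>lborel)" for w
    using c
    by (subst nn_integral_real_affine[of "\<lambda>y. g (y *\<^sub>R b + w)" 1 "w \<bullet> c"])
      (auto simp: algebra_simps inner_commute[of b c])
  then show ?thesis
    using b by (subst (1 2) nn_integral_lborel_split_Basis[OF b]) simp_all
qed

lemma borel_measurable_linear:
  fixes f :: "'a::euclidean_space \<Rightarrow> 'b::euclidean_space"
  shows "linear f \<Longrightarrow> f \<in> borel_measurable borel"
  by (intro borel_measurable_continuous_onI linear_continuous_on)
    (simp add: linear_conv_bounded_linear)

text \<open>
  The property is multiplicative in \<open>f\<close>, so it suffices to treat diagonal maps, transpositions of
  coordinates and shears, which generate all linear maps together with the singular ones.
\<close>
lemma nn_integral_linear_change: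
  fixes f :: "real ^ 'n \<Rightarrow> real ^ 'n" and g :: "real ^ 'n \<Rightarrow> ennreal"
  assumes f: "linear f" and "det (matrix f) \<noteq> 0" and "g \<in> borel_measurable borel"
  shows "(\<integral>\<^sup>+x. g x \<partial>lborel) = ennreal \<bar>det (matrix f)\<bar> * (\<integral>\<^sup>+x. g (f x) \<partial>lborel)"
proof -
  define P where "P f \<longleftrightarrow> (\<forall>g. det (matrix f) \<noteq> 0 \<longrightarrow> g \<in> borel_measurable borel \<longrightarrow>
    (\<integral>\<^sup>+x. g x \<partial>lborel) = ennreal \<bar>det (matrix f)\<bar> * (\<integral>\<^sup>+x. g (f x) \<partial>lborel))"
    for f :: "real ^ 'n \<Rightarrow> real ^ 'n"
  have "P f"
    using f
  proof (rule induct_linear_elementary)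
    fix f h :: "real ^ 'n \<Rightarrow> real ^ 'n"
    assume lin: "linear f" "linear h" and P: "P f" "P h"
    show "P (f \<circ> h)"
      unfolding P_def
    proof (intro allI impI)
      fix g :: "real ^ 'n \<Rightarrow> ennreal"
      assume d: "det (matrix (f \<circ> h)) \<noteq> 0" and g [measurable]: "g \<in> borel_measurable borel"
      have det: "det (matrix (f \<circ> h)) = det (matrix f) * det (matrix h)"
        using lin by (simp add: matrix_compose det_mul)
      have [measurable]: "f \<in> borel_measurable borel"
        by (rule borel_measurable_linear[OF lin(1)])
      have "(\<integral>\<^sup>+x. g x \<partial>lborel) = ennreal \<bar>det (matrix f)\<bar> * (\<integral>\<^sup>+x. g (f x) \<partial>lborel)"
        by (rule P(1)[unfolded P_def, rule_format]) (use d det in auto)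
      also have "(\<integral>\<^sup>+x. g (f x) \<partial>lborel) = ennreal \<bar>det (matrix h)\<bar> * (\<integral>\<^sup>+x. g (f (h x)) \<partial>lborel)"
        by (rule P(2)[unfolded P_def, rule_format]) (use d det in auto)
      finally show "(\<integral>\<^sup>+x. g x \<partial>lborel) =
          ennreal \<bar>det (matrix (f \<circ> h))\<bar> * (\<integral>\<^sup>+x. g ((f \<circ> h) x) \<partial>lborel)"
        by (simp add: det abs_mult ennreal_mult mult.assoc)
    qed
  next
    fix f :: "real ^ 'n \<Rightarrow> real ^ 'n" and i
    assume "linear f" "\<And>x. f x $ i = 0"
    then have "row i (matrix f) = 0" by (simp add: matrix_def row_def vec_eq_iff)
    then show "P f" by (simp add: P_def det_zero_row)
  next
    fix c :: "'n \<Rightarrow> real"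
    let ?f = "\<lambda>x :: real ^ 'n. \<chi> i. c i * x $ i"
    have det: "det (matrix ?f) = (\<Prod>i\<in>UNIV. c i)"
      by (subst det_diagonal) (auto simp: matrix_def axis_def)
    show "P ?f"
      unfolding P_def det
    proof (intro allI impI)
      fix g :: "real ^ 'n \<Rightarrow> ennreal"
      assume c: "(\<Prod>i\<in>UNIV. c i) \<noteq> 0" and [measurable]: "g \<in> borel_measurable borel"
      define c' where "c' b = (\<Sum>i\<in>UNIV. c i * b $ i)" for b :: "real ^ 'n"
      have c'_axis: "c' (axis i 1) = c i" for i
        by (simp add: c'_def axis_def if_distrib cong: if_cong)
      have T: "0 + (\<Sum>b\<in>Basis. (c' b * (x \<bullet> b)) *\<^sub>R b) = ?f x" for x
      proof -
        have "(\<Sum>b\<in>Basis. (c' b * (x \<bullet> b)) *\<^sub>R b) = (\<Sum>i\<in>UNIV. (c i * x $ i) *\<^sub>R axis i 1)"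
          by (simp add: Basis_vec_eq sum.reindex inj_axis c'_axis inner_axis)
        also have "\<dots> = ?f x"
          by (simp add: vec_eq_iff axis_def if_distrib cong: if_cong)
        finally show ?thesis by simp
      qed
      have "lborel = density (distr lborel borel (\<lambda>x. 0 + (\<Sum>b\<in>Basis. (c' b * (x \<bullet> b)) *\<^sub>R b)))
          (\<lambda>_. ennreal (\<Prod>b\<in>Basis. \<bar>c' b\<bar>))"
        using c by (intro lborel_affine_euclidean) (auto simp: Basis_vec_eq c'_axis)
      then have eq: "lborel = density (distr lborel borel ?f) (\<lambda>_. ennreal \<bar>\<Prod>i\<in>UNIV. c i\<bar>)"
        unfolding T by (simp add: Basis_vec_eq prod.reindex inj_axis c'_axis abs_prod)
      have [measurable]: "?f \<in> borel_measurable borel"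
        by (intro borel_measurable_linear linearI) (auto simp: vec_eq_iff algebra_simps)
      show "(\<integral>\<^sup>+x. g x \<partial>lborel) = ennreal \<bar>\<Prod>i\<in>UNIV. c i\<bar> * (\<integral>\<^sup>+x. g (?f x) \<partial>lborel)"
        by (subst eq) (simp add: nn_integral_density nn_integral_distr nn_integral_cmult)
    qed
  next
    fix m n :: 'n assume "m \<noteq> n"
    let ?\<tau> = "Transposition.transpose m n"
    let ?f = "\<lambda>x :: real ^ 'n. \<chi> i. x $ ?\<tau> i"
    have "matrix ?f = (\<chi> i. (mat 1 :: real ^ 'n ^ 'n) $ ?\<tau> i)"
      by (simp add: matrix_def vec_eq_iff mat_def axis_def)
    then have det: "\<bar>det (matrix ?f)\<bar> = 1"
      using det_permute_rows[of ?\<tau> "mat 1 :: real ^ 'n ^ 'n"]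
      by (simp add: permutes_swap_id sign_swap_id abs_mult)
    have [measurable]: "?f \<in> borel_measurable borel"
      by (intro borel_measurable_linear linearI) (auto simp: vec_eq_iff)
    have eq: "lborel = distr lborel borel ?f"
    proof (rule lborel_eqI)
      fix l u :: "real ^ 'n" assume lu: "\<And>b. b \<in> Basis \<Longrightarrow> l \<bullet> b \<le> u \<bullet> b"
      have "?f -` box l u = box (?f l) (?f u)"
        by (auto simp: mem_box_cart) (metis transpose_involutory)+
      then have "emeasure (distr lborel borel ?f) (box l u) = emeasure lborel (box (?f l) (?f u))"
        by (simp add: emeasure_distr)
      also have "\<dots> = ennreal (\<Prod>b\<in>Basis. (?f u - ?f l) \<bullet> b)"
        using lu[of "axis _ 1"] by (subst emeasure_lborel_box) (auto simp: Basis_vec_eq inner_axis)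
      also have "(\<Prod>b\<in>Basis. (?f u - ?f l) \<bullet> b) = (\<Prod>i\<in>UNIV. (u - l) $ ?\<tau> i)"
        by (simp add: Basis_vec_eq prod.reindex inj_axis inner_axis)
      also have "\<dots> = (\<Prod>i\<in>UNIV. (u - l) $ i)"
        using prod.permute[OF permutes_swap_id[of m UNIV n], of "\<lambda>i. (u - l) $ i"] by simp
      also have "\<dots> = (\<Prod>b\<in>Basis. (u - l) \<bullet> b)"
        by (simp add: Basis_vec_eq prod.reindex inj_axis inner_axis)
      finally show "emeasure (distr lborel borel ?f) (box l u) = ennreal (\<Prod>b\<in>Basis. (u - l) \<bullet> b)" .
    qed simp
    show "P ?f"
      unfolding P_def det by (auto, subst eq, simp add: nn_integral_distr)
  next
    fix m n :: 'n assume mn: "m \<noteq> n"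
    let ?f = "\<lambda>x :: real ^ 'n. \<chi> i. if i = m then x $ m + x $ n else x $ i"
    have "matrix ?f = (\<chi> k. if k = m then row m (mat 1) + 1 *s row n (mat 1) else row k (mat 1))"
      by (auto simp: matrix_def vec_eq_iff mat_def axis_def row_def)
    then have det: "det (matrix ?f) = 1"
      using det_row_operation[OF mn, of "mat 1" 1] by simp
    have f: "?f v = v + (v \<bullet> axis n 1) *\<^sub>R axis m 1" for v
      unfolding inner_axis by (simp add: vec_eq_iff axis_def)
    show "P ?f"
      unfolding P_def f det[unfolded f]
      using mn by (auto intro!: nn_integral_lborel_shear[symmetric] simp: inner_axis_axis)
  qed
  then show ?thesis using assms by (simp add: P_def)
qed

lemma nn_integral_matrix_change:
  fixes B :: "real ^ 'n ^ 'n"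
  assumes "det B \<noteq> 0" and "f \<in> borel_measurable borel"
  shows "(\<integral>\<^sup>+x. f x \<partial>lborel) = ennreal \<bar>det B\<bar> * (\<integral>\<^sup>+z. f (B *v z) \<partial>lborel)"
  using nn_integral_linear_change[of "(*v) B" f] assms by simp

lemma nn_integral_prod_components:
  fixes f :: "'n::finite \<Rightarrow> real \<Rightarrow> ennreal"
  assumes [measurable]: "\<And>i. f i \<in> borel_measurable borel"
  shows "(\<integral>\<^sup>+x. (\<Prod>i\<in>UNIV. f i ((x :: real ^ 'n) $ i)) \<partial>lborel) = (\<Prod>i\<in>UNIV. \<integral>\<^sup>+s. f i s \<partial>lborel)"
proof -
  define g where "g b = f (THE i. b = axis i 1)" for b :: "real ^ 'n"
  have g: "g (axis i 1) = f i" for i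
    by (simp add: g_def axis_eq_axis)
  have "(\<integral>\<^sup>+x. (\<Prod>b\<in>Basis. g b (x \<bullet> b)) \<partial>lborel) = (\<Prod>b\<in>Basis. \<integral>\<^sup>+s. g b s \<partial>lborel)"
    by (rule nn_integral_lborel_prod) (simp_all add: g_def)
  then show ?thesis
    by (simp add: Basis_vec_eq prod.reindex inj_axis g cart_eq_inner_axis)
qed

lemma nn_integral_lborel_translate:
  fixes f :: "'a::euclidean_space \<Rightarrow> ennreal"
  assumes [measurable]: "f \<in> borel_measurable borel"
  shows "(\<integral>\<^sup>+x. f (c + x) \<partial>lborel) = (\<integral>\<^sup>+x. f x \<partial>lborel)"
proof -
  have "(\<integral>\<^sup>+x. f x \<partial>lborel) = (\<integral>\<^sup>+x. f x \<partial>distr lborel borel ((+) c))"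
    by (simp only: lborel_distr_plus)
  then show ?thesis by (simp add: nn_integral_distr)
qed

lemma nn_integral_lborel_reflect:
  fixes f :: "'a::euclidean_space \<Rightarrow> ennreal"
  assumes [measurable]: "f \<in> borel_measurable borel"
  shows "(\<integral>\<^sup>+x. f (c - x) \<partial>lborel) = (\<integral>\<^sup>+x. f x \<partial>lborel)"
proof -
  have "(\<integral>\<^sup>+x. f x \<partial>lborel) =
      (\<integral>\<^sup>+x. f x \<partial>density (distr lborel borel (\<lambda>x. c + (-1) *\<^sub>R x)) (\<lambda>_. ennreal (\<bar>- 1\<bar> ^ DIM('a))))"
    by (subst lborel_affine[of "-1" c]) auto
  then show ?thesis by (simp add: nn_integral_distr nn_integral_density)
qed

section \<open>Convolution of normal densities\<close>

lemma matrix_inv_matrix_inv: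
  fixes A :: "real ^ 'n ^ 'n"
  assumes "invertible A"
  shows "matrix_inv (matrix_inv A) = A"
proof -
  note A = invertible_matrix_inv[OF assms]
  have "invertible (matrix_inv A)" using A unfolding invertible_def by blast
  note A' = invertible_matrix_inv[OF this]
  have "matrix_inv (matrix_inv A) = (A ** matrix_inv A) ** matrix_inv (matrix_inv A)"
    by (simp add: A)
  also have "\<dots> = A" by (simp add: A' flip: matrix_mul_assoc)
  finally show ?thesis .
qed

lemma mvn_density_location:
  "mvn_density \<mu> \<Sigma> x = mvn_density 0 \<Sigma> (x - \<mu>)"
  by (simp add: mvn_density_def)

lemma mvn_density_uminus:
  "mvn_density 0 \<Sigma> (- x) = mvn_density 0 \<Sigma> x"
  by (simp add: mvn_density_def mult_minus_right matrix_vector_mult_def inner_vec_def sum_negf)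

lemma mvn_density_pos:
  "pos_def_matrix \<Sigma> \<Longrightarrow> 0 < mvn_density \<mu> \<Sigma> x"
  by (simp add: mvn_density_def pos_def_matrix_det_pos)

lemma mvn_density_le:
  fixes \<Sigma> :: "real ^ 'n ^ 'n"
  shows "pos_def_matrix \<Sigma> \<Longrightarrow> mvn_density \<mu> \<Sigma> x \<le> 1 / sqrt ((2 * pi) ^ CARD('n) * det \<Sigma>)"
  using pos_def_matrix_inv_nonneg[of \<Sigma>] pos_def_matrix_det_pos[of \<Sigma>]
  by (auto simp: mvn_density_def intro!: divide_right_mono)

lemma borel_measurable_mvn_density [measurable]:
  "mvn_density \<mu> \<Sigma> \<in> borel_measurable borel"
  using measurable_compose[OF _ measurable_mvn_density[of \<mu> 0 \<Sigma>], of "\<lambda>t. (0, t)" borel] by simp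

text \<open>
  In whitened coordinates the quadratic form in the exponent is a sum of squares.
\<close>
lemma mvn_density_whitened:
  fixes \<Sigma> B :: "real ^ 'n ^ 'n"
  assumes \<Sigma>: "pos_def_matrix \<Sigma>"
    and B: "\<And>x. (B *v x) \<bullet> (matrix_inv \<Sigma> *v (B *v x)) = x \<bullet> x"
  shows "mvn_density (B *v m) \<Sigma> (B *v z) =
    (\<Prod>i\<in>UNIV. std_normal_density (z $ i - m $ i)) / sqrt (det \<Sigma>)"
proof -
  have "(B *v z - B *v m) \<bullet> (matrix_inv \<Sigma> *v (B *v z - B *v m)) = (z - m) \<bullet> (z - m)"
    using B[of "z - m"] by (simp add: matrix_vector_mult_diff_distrib)
  also have "\<dots> = (\<Sum>i\<in>UNIV. (z $ i - m $ i)\<^sup>2)"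
    by (simp add: inner_vec_def power2_eq_square)
  finally show ?thesis
    by (simp add: mvn_density_def std_normal_density_def prod_dividef prod.distrib
        exp_sum[symmetric] sum_negf sum_divide_distrib real_sqrt_mult real_sqrt_power
        power_mult_distrib)
qed

lemma nn_integral_std_normal_density: "(\<integral>\<^sup>+x. ennreal (std_normal_density x) \<partial>lborel) = 1"
  using prob_space.emeasure_space_1[OF prob_space_normal_density[of 1 0]]
  by (simp add: emeasure_density)

lemma nn_integral_std_normal_density_shift:
  "(\<integral>\<^sup>+x. ennreal (std_normal_density (x - c)) \<partial>lborel) = 1"
  using nn_integral_lborel_translate[of "\<lambda>x. ennreal (std_normal_density x)" "- c"]
  by (simp add: nn_integral_std_normal_density)

lemma nn_integral_mvn_density:
  fixes \<Sigma> :: "real ^ 'n ^ 'n"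
  assumes \<Sigma>: "pos_def_matrix \<Sigma>"
  shows "(\<integral>\<^sup>+x. ennreal (mvn_density \<mu> \<Sigma> x) \<partial>lborel) = 1"
proof -
  obtain B :: "real ^ 'n ^ 'n"
    where B: "\<And>x. (B *v x) \<bullet> (matrix_inv \<Sigma> *v (B *v x)) = x \<bullet> x"
      and det: "\<bar>det B\<bar> = sqrt (det \<Sigma>)" "det B \<noteq> 0"
    by (rule whitening_matrix_exists[OF \<Sigma>, of "axis undefined 1"]) (auto simp: axis_eq_0_iff)
  have [measurable]: "(*v) B \<in> borel_measurable borel"
    by (rule borel_measurable_linear[OF matrix_vector_mul_linear])
  have "(\<integral>\<^sup>+x. ennreal (mvn_density \<mu> \<Sigma> x) \<partial>lborel) = (\<integral>\<^sup>+x. ennreal (mvn_density 0 \<Sigma> x) \<partial>lborel)"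
    using nn_integral_lborel_translate[of "\<lambda>x. ennreal (mvn_density 0 \<Sigma> x)" "- \<mu>"]
    by (simp add: mvn_density_location[of \<mu>])
  also have "\<dots> = ennreal \<bar>det B\<bar> * (\<integral>\<^sup>+z. ennreal (mvn_density 0 \<Sigma> (B *v z)) \<partial>lborel)"
    by (rule nn_integral_matrix_change) (simp_all add: det)
  also have "\<dots> = (\<integral>\<^sup>+z. ennreal \<bar>det B\<bar> * ennreal (mvn_density 0 \<Sigma> (B *v z)) \<partial>lborel)"
    by (rule nn_integral_cmult[symmetric]) measurable
  also have "\<dots> = (\<integral>\<^sup>+z. (\<Prod>i\<in>UNIV. ennreal (std_normal_density ((z :: real ^ 'n) $ i))) \<partial>lborel)"
  proof (rule nn_integral_cong)
    fix z :: "real ^ 'n"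
    have "\<bar>det B\<bar> * mvn_density 0 \<Sigma> (B *v z) = (\<Prod>i\<in>UNIV. std_normal_density (z $ i))"
      using mvn_density_whitened[OF \<Sigma> B, of 0 z] det pos_def_matrix_det_pos[OF \<Sigma>] by simp
    then show "ennreal \<bar>det B\<bar> * ennreal (mvn_density 0 \<Sigma> (B *v z)) =
        (\<Prod>i\<in>UNIV. ennreal (std_normal_density (z $ i)))"
      by (subst prod_ennreal) (simp_all add: ennreal_mult'[symmetric])
  qed
  also have "\<dots> = 1"
    by (subst nn_integral_prod_components) (simp_all add: nn_integral_std_normal_density)
  finally show ?thesis .
qed

text \<open>
  Completing the square.  With \<open>S = \<Sigma>X + \<Sigma>Y\<close>, write \<open>z = S *v w\<close> and \<open>u = \<Sigma>X *v w + h\<close>, hence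
  \<open>z - u = \<Sigma>Y *v w - h\<close>; the mixed terms \<open>2 * (h \<bullet> w)\<close> of the two quadratic forms then cancel.  The
  normalising constants match because \<open>A + B = A ** S ** B\<close> for the inverses \<open>A\<close> and \<open>B\<close> of \<open>\<Sigma>X\<close>
  and \<open>\<Sigma>Y\<close>.
\<close>
lemma mvn_density_mult:
  fixes \<Sigma>X \<Sigma>Y :: "real ^ 'n ^ 'n"
  assumes X: "pos_def_matrix \<Sigma>X" and Y: "pos_def_matrix \<Sigma>Y"
  defines "T \<equiv> matrix_inv (matrix_inv \<Sigma>X + matrix_inv \<Sigma>Y)"
  defines "m \<equiv> (\<lambda>z. \<Sigma>X *v (matrix_inv (\<Sigma>X + \<Sigma>Y) *v z))"
  shows "mvn_density 0 \<Sigma>Y (z - u) * mvn_density 0 \<Sigma>X u =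
    mvn_density 0 (\<Sigma>X + \<Sigma>Y) z * mvn_density (m z) T u"
proof -
  define A where "A = matrix_inv \<Sigma>X"
  define B where "B = matrix_inv \<Sigma>Y"
  define S where "S = \<Sigma>X + \<Sigma>Y"
  define w where "w = matrix_inv S *v z"
  define h where "h = u - m z"
  note S = pos_def_matrix_add[OF X Y, folded S_def]
  note A = pos_def_matrix_inverse[OF X, folded A_def]
  note B = pos_def_matrix_inverse[OF Y, folded B_def]
  note K = pos_def_matrix_add[OF A B]
  note invX = invertible_matrix_inv[OF pos_def_matrix_invertible[OF X], folded A_def]
  note invY = invertible_matrix_inv[OF pos_def_matrix_invertible[OF Y], folded B_def]
  note invS = invertible_matrix_inv[OF pos_def_matrix_invertible[OF S]]
  have u: "u = \<Sigma>X *v w + h" by (simp add: h_def m_def w_def S_def)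
  have "z = S *v w" by (simp add: w_def matrix_vector_mul_assoc invS)
  then have z: "z = \<Sigma>X *v w + \<Sigma>Y *v w"
    by (simp add: S_def matrix_vector_mult_add_rdistrib)
  have Au: "A *v u = w + A *v h"
    by (simp add: u matrix_vector_right_distrib matrix_vector_mul_assoc invX)
  have Bzu: "B *v (z - u) = w - B *v h"
    by (simp add: u z matrix_vector_mult_diff_distrib matrix_vector_mul_assoc invY)
  have cross: "(\<Sigma>X *v w) \<bullet> (A *v h) = h \<bullet> w" "(\<Sigma>Y *v w) \<bullet> (B *v h) = h \<bullet> w"
    using pos_def_matrix_symmetric_form[OF A, of "\<Sigma>X *v w" h]
      pos_def_matrix_symmetric_form[OF B, of "\<Sigma>Y *v w" h]
    by (simp_all add: matrix_vector_mul_assoc invX invY)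
  have quad: "(z - u) \<bullet> (B *v (z - u)) + u \<bullet> (A *v u) = z \<bullet> w + h \<bullet> ((A + B) *v h)"
    unfolding Au Bzu
    by (simp add: u z inner_add_left inner_add_right inner_diff_left inner_diff_right cross
        matrix_vector_mult_add_rdistrib)
  have "A + B = A ** S ** B"
    by (simp add: matrix_eq S_def matrix_vector_mult_add_rdistrib matrix_vector_right_distrib
        matrix_vector_mul_assoc[symmetric] add.commute)
      (simp add: matrix_vector_mul_assoc matrix_mul_assoc[of A \<Sigma>X B] invX invY)
  then have "det (A + B) = det S / (det \<Sigma>X * det \<Sigma>Y)"
    by (simp add: det_mul A_def B_def det_matrix_inv pos_def_matrix_invertible X Y)
  then have detT: "det T = det \<Sigma>X * det \<Sigma>Y / det S"
    by (simp add: T_def det_matrix_inv pos_def_matrix_invertible K flip: A_def B_def)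
  have invT: "matrix_inv T = A + B"
    by (simp add: T_def matrix_inv_matrix_inv pos_def_matrix_invertible K flip: A_def B_def)
  note pos = pos_def_matrix_det_pos[OF X] pos_def_matrix_det_pos[OF Y] pos_def_matrix_det_pos[OF S]
  let ?c = "(2 * pi) ^ CARD('n)"
  have norm: "sqrt (?c * det \<Sigma>Y) * sqrt (?c * det \<Sigma>X) = sqrt (?c * det S) * sqrt (?c * det T)"
    using pos by (simp add: detT flip: real_sqrt_mult)
  have "exp (- ((z - u) \<bullet> (B *v (z - u))) / 2) * exp (- (u \<bullet> (A *v u)) / 2) =
      exp (- (z \<bullet> w) / 2) * exp (- (h \<bullet> ((A + B) *v h)) / 2)"
    using quad by (simp flip: exp_add add: field_simps)
  then show ?thesis
    by (simp only: mvn_density_def diff_zero times_divide_times_eq norm invT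
        A_def[symmetric] B_def[symmetric] S_def[symmetric] w_def[symmetric] h_def[symmetric])
qed

lemma nn_integral_mvn_density_convolution:
  fixes \<Sigma>X \<Sigma>Y :: "real ^ 'n ^ 'n"
  assumes X: "pos_def_matrix \<Sigma>X" and Y: "pos_def_matrix \<Sigma>Y"
  shows "(\<integral>\<^sup>+\<theta>. ennreal (mvn_density (\<theta> + b) \<Sigma>Y y) * ennreal (mvn_density (\<theta> + a) \<Sigma>X x) \<partial>lborel) =
    ennreal (mvn_density (b - a) (\<Sigma>X + \<Sigma>Y) (y - x))"
proof -
  let ?T = "matrix_inv (matrix_inv \<Sigma>X + matrix_inv \<Sigma>Y)"
  let ?z = "y - x - (b - a)"
  have T: "pos_def_matrix ?T"
    by (intro pos_def_matrix_inverse pos_def_matrix_add X Y)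
  let ?f = "\<lambda>\<theta>. ennreal (mvn_density (\<theta> + b) \<Sigma>Y y) * ennreal (mvn_density (\<theta> + a) \<Sigma>X x)"
  have [measurable]: "?f \<in> borel_measurable borel"
    unfolding mvn_density_location[of "_ + _"] by measurable
  have f: "?f (x - a + u) = ennreal (mvn_density 0 (\<Sigma>X + \<Sigma>Y) ?z) *
      ennreal (mvn_density (\<Sigma>X *v (matrix_inv (\<Sigma>X + \<Sigma>Y) *v ?z)) ?T u)" for u
  proof -
    have "mvn_density (x - a + u + b) \<Sigma>Y y = mvn_density 0 \<Sigma>Y (?z - u)"
      by (subst mvn_density_location) (simp add: algebra_simps)
    moreover have "mvn_density (x - a + u + a) \<Sigma>X x = mvn_density 0 \<Sigma>X u"
      by (subst mvn_density_location) (simp add: mvn_density_uminus)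
    ultimately show ?thesis
      using mvn_density_mult[OF X Y, of ?z u] mvn_density_pos[OF X, THEN less_imp_le]
        mvn_density_pos[OF T, THEN less_imp_le]
      by (simp flip: ennreal_mult'')
  qed
  have "(\<integral>\<^sup>+\<theta>. ?f \<theta> \<partial>lborel) = (\<integral>\<^sup>+u. ?f (x - a + u) \<partial>lborel)"
    by (rule nn_integral_lborel_translate[symmetric]) measurable
  also have "\<dots> = ennreal (mvn_density 0 (\<Sigma>X + \<Sigma>Y) ?z)"
    unfolding f by (simp add: nn_integral_cmult nn_integral_mvn_density[OF T])
  finally show ?thesis by (simp add: mvn_density_location[of "b - a"])
qed

section \<open>Mean-mixtures of normal densities\<close>

lemma mmn_density_location:
  "mmn_density \<theta> a \<Sigma> L t = mmn_density 0 a \<Sigma> L (t - \<theta>)"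
  by (simp add: mmn_density_def mvn_density_location[of "_ + _"] mvn_density_location[of "_ *\<^sub>R _"]
      diff_diff_eq)

lemma measurable_mvn_density_mixing:
  assumes N: "real_distribution N"
  shows "(\<lambda>(v, t). mvn_density (\<theta> + v *\<^sub>R a) \<Sigma> t) \<in> borel_measurable (N \<Otimes>\<^sub>M borel)"
proof -
  interpret real_distribution N by fact
  show ?thesis using measurable_mvn_density[of \<theta> a \<Sigma>] by simp
qed

lemma mmn_density_mixture:
  fixes \<Sigma> :: "real ^ 'n ^ 'n"
  assumes N: "real_distribution N" and \<Sigma>: "pos_def_matrix \<Sigma>"
  shows "integrable N (\<lambda>v. mvn_density (\<theta> + v *\<^sub>R a) \<Sigma> t)"
    and "mmn_density \<theta> a \<Sigma> (cdf N) t = (\<integral>v. mvn_density (\<theta> + v *\<^sub>R a) \<Sigma> t \<partial>N)"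
    and "ennreal (mmn_density \<theta> a \<Sigma> (cdf N) t) = (\<integral>\<^sup>+v. ennreal (mvn_density (\<theta> + v *\<^sub>R a) \<Sigma> t) \<partial>N)"
proof -
  interpret real_distribution N by fact
  note [measurable] = measurable_mvn_density_mixing[OF N]
  show int: "integrable N (\<lambda>v. mvn_density (\<theta> + v *\<^sub>R a) \<Sigma> t)"
    using mvn_density_le[OF \<Sigma>] mvn_density_pos[OF \<Sigma>, THEN less_imp_le]
    by (intro integrable_const_bound[where B = "1 / sqrt ((2 * pi) ^ CARD('n) * det \<Sigma>)"]) auto
  show eq: "mmn_density \<theta> a \<Sigma> (cdf N) t = (\<integral>v. mvn_density (\<theta> + v *\<^sub>R a) \<Sigma> t \<partial>N)"
    by (simp add: mmn_density_def interval_measure_cdf[OF N])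
  show "ennreal (mmn_density \<theta> a \<Sigma> (cdf N) t) = (\<integral>\<^sup>+v. ennreal (mvn_density (\<theta> + v *\<^sub>R a) \<Sigma> t) \<partial>N)"
    unfolding eq using mvn_density_pos[OF \<Sigma>, THEN less_imp_le]
    by (intro nn_integral_eq_integral[symmetric] int) auto
qed

lemma mmn_density_pos:
  assumes N: "real_distribution N" and \<Sigma>: "pos_def_matrix \<Sigma>"
  shows "0 < mmn_density \<theta> a \<Sigma> (cdf N) t"
proof -
  interpret real_distribution N by fact
  show ?thesis
    unfolding mmn_density_mixture(2)[OF N \<Sigma>]
    using mvn_density_pos[OF \<Sigma>] by (intro expectation_greater mmn_density_mixture(1)[OF N \<Sigma>]) simp
qed

lemma mmn_density_le:
  fixes \<Sigma> :: "real ^ 'n ^ 'n"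
  assumes N: "real_distribution N" and \<Sigma>: "pos_def_matrix \<Sigma>"
  shows "mmn_density \<theta> a \<Sigma> (cdf N) t \<le> 1 / sqrt ((2 * pi) ^ CARD('n) * det \<Sigma>)"
proof -
  interpret real_distribution N by fact
  show ?thesis
    unfolding mmn_density_mixture(2)[OF N \<Sigma>]
    using mmn_density_mixture(1)[OF N \<Sigma>] mvn_density_le[OF \<Sigma>] by (intro integral_le_const) auto
qed

lemma borel_measurable_mmn_density:
  assumes N: "real_distribution N" and \<Sigma>: "pos_def_matrix \<Sigma>"
  shows "mmn_density \<theta> a \<Sigma> (cdf N) \<in> borel_measurable borel"
proof -
  interpret real_distribution N by fact
  have [measurable]: "(\<lambda>(t, v). mvn_density (\<theta> + v *\<^sub>R a) \<Sigma> t) \<in> borel_measurable (borel \<Otimes>\<^sub>M N)"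
    using measurable_compose[OF measurable_pair_swap' measurable_mvn_density_mixing[OF N, of \<theta> a \<Sigma>]]
    by (simp add: case_prod_beta)
  show ?thesis
    unfolding mmn_density_mixture(2)[OF N \<Sigma>, abs_def] by measurable
qed

lemma nn_integral_mmn_density:
  fixes \<Sigma> :: "real ^ 'n ^ 'n"
  assumes N: "real_distribution N" and \<Sigma>: "pos_def_matrix \<Sigma>"
  shows "(\<integral>\<^sup>+t. ennreal (mmn_density \<theta> a \<Sigma> (cdf N) t) \<partial>lborel) = 1"
proof -
  interpret real_distribution N by fact
  have "(\<integral>\<^sup>+t. ennreal (mmn_density \<theta> a \<Sigma> (cdf N) t) \<partial>lborel) =
      emeasure (density lborel (mmn_density \<theta> a \<Sigma> (cdf N))) UNIV"
    using borel_measurable_mmn_density[OF N \<Sigma>] by (simp add: emeasure_density)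
  also have "\<dots> = 1"
    by (subst emeasure_mmn_density[OF N \<Sigma>])
      (simp_all add: emeasure_density nn_integral_mvn_density[OF \<Sigma>] emeasure_space_1[simplified])
  finally show ?thesis .
qed

text \<open>
  The difference of two independent mean-mixtures is the mean-mixture for the difference of the mixing
  variables: exchange the integrals and apply the convolution of normal densities for each pair of
  mixing values.
\<close>
lemma nn_integral_mmn_density_convolution:
  fixes \<Sigma>X \<Sigma>Y :: "real ^ 'n ^ 'n"
  assumes N1: "real_distribution N1" and N2: "real_distribution N2"
    and X: "pos_def_matrix \<Sigma>X" and Y: "pos_def_matrix \<Sigma>Y"
  shows "(\<integral>\<^sup>+\<theta>. ennreal (mmn_density \<theta> a \<Sigma>Y (cdf N2) y) * ennreal (mmn_density \<theta> a \<Sigma>X (cdf N1) x) \<partial>lborel) =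
    ennreal (mmn_density 0 a (\<Sigma>X + \<Sigma>Y) (cdf (distr (N1 \<Otimes>\<^sub>M N2) borel (\<lambda>(v1, v2). v2 - v1))) (y - x))"
proof -
  interpret N1: real_distribution N1 by fact
  interpret N2: real_distribution N2 by fact
  interpret N12: pair_prob_space N1 N2 ..
  interpret L1: pair_sigma_finite N1 "lborel :: (real ^ 'n) measure" ..
  interpret L2: pair_sigma_finite N2 "lborel :: (real ^ 'n) measure" ..
  let ?N3 = "distr (N1 \<Otimes>\<^sub>M N2) borel (\<lambda>(v1, v2). v2 - v1)"
  have meas_diff [measurable]: "(\<lambda>(v1, v2). v2 - v1 :: real) \<in> borel_measurable (N1 \<Otimes>\<^sub>M N2)"
    by measurable
  have N3: "real_distribution ?N3"
    by (rule N12.real_distribution_distr) measurable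
  let ?f = "\<lambda>v1 v2 \<theta>. ennreal (mvn_density (\<theta> + v2 *\<^sub>R a) \<Sigma>Y y) * ennreal (mvn_density (\<theta> + v1 *\<^sub>R a) \<Sigma>X x)"
  \<comment> \<open>With the location moved into the argument, joint measurability in \<open>v\<close> and \<open>\<theta>\<close> is a composition.\<close>
  have loc: "mvn_density (\<theta> + v *\<^sub>R a) \<Sigma> t = mvn_density (v *\<^sub>R a) \<Sigma> (t - \<theta>)" for v \<theta> \<Sigma> t
    by (simp add: mvn_density_location[of "\<theta> + v *\<^sub>R a"] mvn_density_location[of "v *\<^sub>R a"] diff_diff_eq)
  note [measurable] = measurable_mvn_density_mixing[OF N1, of 0 a, unfolded add_0_left]
    measurable_mvn_density_mixing[OF N2, of 0 a, unfolded add_0_left]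
    measurable_mvn_density[of 0 a, unfolded add_0_left]
  have "(\<integral>\<^sup>+\<theta>. ennreal (mmn_density \<theta> a \<Sigma>Y (cdf N2) y) * ennreal (mmn_density \<theta> a \<Sigma>X (cdf N1) x) \<partial>lborel) =
      (\<integral>\<^sup>+\<theta>. (\<integral>\<^sup>+v1. (\<integral>\<^sup>+v2. ?f v1 v2 \<theta> \<partial>N2) \<partial>N1) \<partial>lborel)"
    unfolding mmn_density_mixture(3)[OF N1 X] mmn_density_mixture(3)[OF N2 Y] loc
    by (simp add: nn_integral_cmult nn_integral_multc)
  also have "\<dots> = (\<integral>\<^sup>+v1. (\<integral>\<^sup>+\<theta>. (\<integral>\<^sup>+v2. ?f v1 v2 \<theta> \<partial>N2) \<partial>lborel) \<partial>N1)"
    unfolding loc by (rule L1.Fubini') measurable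
  also have "\<dots> = (\<integral>\<^sup>+v1. (\<integral>\<^sup>+v2. (\<integral>\<^sup>+\<theta>. ?f v1 v2 \<theta> \<partial>lborel) \<partial>N2) \<partial>N1)"
    unfolding loc by (intro nn_integral_cong L2.Fubini') measurable
  also have "\<dots> = (\<integral>\<^sup>+v1. (\<integral>\<^sup>+v2. ennreal (mvn_density ((v2 - v1) *\<^sub>R a) (\<Sigma>X + \<Sigma>Y) (y - x)) \<partial>N2) \<partial>N1)"
    by (simp add: nn_integral_mvn_density_convolution[OF X Y] scaleR_diff_left)
  also have "\<dots> = (\<integral>\<^sup>+v. ennreal (mvn_density (v *\<^sub>R a) (\<Sigma>X + \<Sigma>Y) (y - x)) \<partial>?N3)"
    by (subst nn_integral_distr) (simp_all add: N2.nn_integral_fst[symmetric] case_prod_beta)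
  also have "\<dots> = ennreal (mmn_density 0 a (\<Sigma>X + \<Sigma>Y) (cdf ?N3) (y - x))"
    using mmn_density_mixture(3)[OF N3 pos_def_matrix_add[OF X Y], of 0 a] by simp
  finally show ?thesis .
qed

section \<open>Entropy and Kullback-Leibler divergence of bounded densities\<close>

lemma ext_integral_ereal:
  "ext_integral M (\<lambda>x. ereal (f x)) =
    enn2ereal (\<integral>\<^sup>+x. ennreal (f x) \<partial>M) - enn2ereal (\<integral>\<^sup>+x. ennreal (- f x) \<partial>M)"
  by (simp add: ext_integral_def)

lemma ext_integral_enn2ereal:
  "ext_integral M (\<lambda>x. enn2ereal (g x)) = enn2ereal (\<integral>\<^sup>+x. g x \<partial>M)"
  by (simp add: ext_integral_def e2ennreal_neg zero_ennreal.rep_eq)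

text \<open>
  The entropy of \<open>f\<close> with respect to the measure \<open>C\<close> times Lebesgue measure.  For a bound \<open>C\<close> of
  \<open>f\<close> the integrand is nonnegative, so that the value is a well-defined extended nonnegative real.
\<close>
definition scaled_entropy :: "('a::euclidean_space \<Rightarrow> real) \<Rightarrow> real \<Rightarrow> ennreal" where
  "scaled_entropy f C = (\<integral>\<^sup>+t. ennreal (f t * ln (C / f t)) \<partial>lborel)"

text \<open>
  For a bounded density the positive part of \<open>f ln f\<close> is integrable, so the entropy is never \<open>-\<infinity>\<close>
  and differs from its scaled version by the constant \<open>ln C\<close>.  The integrands satisfy
  \<open>f ln (C / f) = f c - f ln f\<close> with \<open>c = ln C\<close>; splitting every term into its positive and negative
  part turns this into an identity between nonnegative functions that can be integrated termwise.
\<close>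
lemma diff_entropy_bounded_density:
  fixes f :: "real ^ 'n \<Rightarrow> real"
  assumes [measurable]: "f \<in> borel_measurable borel"
    and pos: "\<And>t. 0 < f t" and le: "\<And>t. f t \<le> C"
    and one: "(\<integral>\<^sup>+t. ennreal (f t) \<partial>lborel) = 1"
  shows "diff_entropy f = enn2ereal (scaled_entropy f C) - ereal (ln C)"
proof -
  define c where "c = ln C"
  have C: "0 < C" using pos[of 0] le[of 0] by linarith
  have nonneg: "0 \<le> f t" for t using pos[of t] by simp
  have ln: "ln (C / f t) = c - ln (f t)" "ln (f t) \<le> c" for t
    using pos[of t] le[of t] C by (simp_all add: c_def ln_div)
  define A where "A = (\<integral>\<^sup>+t. ennreal (f t * ln (f t)) \<partial>lborel)"
  define B where "B = (\<integral>\<^sup>+t. ennreal (- (f t * ln (f t))) \<partial>lborel)"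
  define J where "J = scaled_entropy f C"
  have const: "(\<integral>\<^sup>+t. ennreal (f t * k) \<partial>lborel) = ennreal k" if "0 \<le> k" for k
    using that nonneg by (simp add: ennreal_mult nn_integral_multc one)
  have "A \<le> (\<integral>\<^sup>+t. ennreal (f t * max 0 c) \<partial>lborel)"
    unfolding A_def using ln(2) nonneg
    by (intro nn_integral_mono ennreal_leI mult_left_mono) (auto intro: max.coboundedI2)
  then have A: "A \<noteq> \<infinity>" by (auto simp: const top_unique)
  have pointwise: "ennreal (f t * ln (f t)) + ennreal (f t * ln (C / f t)) + ennreal (f t * max 0 (- c))
      = ennreal (- (f t * ln (f t))) + ennreal (f t * max 0 c)" for t
  proof -
    have "max 0 (f t * ln (f t)) + f t * ln (C / f t) + f t * max 0 (- c)
        = max 0 (- (f t * ln (f t))) + f t * max 0 c"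
      by (auto simp: ln max_def algebra_simps)
    moreover have "0 \<le> f t * ln (C / f t)" using nonneg ln by simp
    ultimately have "ennreal (max 0 (f t * ln (f t))) + ennreal (f t * ln (C / f t)) + ennreal (f t * max 0 (- c))
        = ennreal (max 0 (- (f t * ln (f t)))) + ennreal (f t * max 0 c)"
      using nonneg by (simp add: ennreal_plus[symmetric] del: ennreal_plus ennreal_max_0)
    then show ?thesis by (simp add: ennreal_max_0)
  qed
  have "A + J + ennreal (max 0 (- c)) = (\<integral>\<^sup>+t. ennreal (f t * ln (f t)) + ennreal (f t * ln (C / f t))
      + ennreal (f t * max 0 (- c)) \<partial>lborel)"
    unfolding A_def J_def scaled_entropy_def by (simp add: nn_integral_add const)
  also have "\<dots> = B + ennreal (max 0 c)"
    unfolding pointwise B_def by (simp add: nn_integral_add const)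
  finally have eq: "A + J + ennreal (max 0 (- c)) = B + ennreal (max 0 c)" .
  have "- (enn2ereal A - enn2ereal B) = enn2ereal J - ereal c"
  proof (cases J)
    case top
    with eq have "B = top" by (metis ennreal_add_eq_top ennreal_neq_top add_top_left_ennreal top_add)
    with top A show ?thesis by (cases A) auto
  next
    case (real j)
    obtain a where a: "A = ennreal a" "0 \<le> a" using A by (cases A) auto
    have "B \<noteq> top" using eq real a by (metis ennreal_add_eq_top ennreal_neq_top)
    then obtain b where b: "B = ennreal b" "0 \<le> b" by (cases B) auto
    have "ennreal (a + j + max 0 (- c)) = ennreal (b + max 0 c)"
      using eq real a b by (simp add: ennreal_plus[symmetric] del: ennreal_plus ennreal_max_0)
    then have "a + j + max 0 (- c) = b + max 0 c"
      using real a b by (subst (asm) ennreal_inj) auto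
    then show ?thesis using real a b by (auto simp: enn2ereal_ennreal max_def split: if_splits)
  qed
  then show ?thesis
    by (simp add: diff_entropy_def ext_integral_ereal A_def B_def J_def c_def)
qed

text \<open>
  Both claims integrate \<open>q ln (q / r) \<ge> q - r\<close>, which is the tangent bound \<open>ln t \<le> t - 1\<close> at
  \<open>t = r / q\<close>.
\<close>
lemma gibbs_inequality:
  fixes q r :: "'a::euclidean_space \<Rightarrow> real"
  assumes [measurable]: "q \<in> borel_measurable borel" "r \<in> borel_measurable borel"
    and pos: "\<And>y. 0 < q y" "\<And>y. 0 < r y"
    and one: "(\<integral>\<^sup>+y. ennreal (q y) \<partial>lborel) = 1" "(\<integral>\<^sup>+y. ennreal (r y) \<partial>lborel) = 1"
  defines "kl \<equiv> \<lambda>y. q y * ln (q y / r y)"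
  shows "(\<integral>\<^sup>+y. ennreal (- kl y) \<partial>lborel) \<noteq> \<infinity>"
    and "(\<integral>\<^sup>+y. ennreal (- kl y) \<partial>lborel) \<le> (\<integral>\<^sup>+y. ennreal (kl y) \<partial>lborel)"
proof -
  have [measurable]: "kl \<in> borel_measurable borel" unfolding kl_def by measurable
  have ge: "q y - r y \<le> kl y" for y
  proof -
    have "ln (r y / q y) \<le> r y / q y - 1" using pos[of y] by (intro ln_le_minus_one) simp
    then have "q y * ln (r y / q y) \<le> q y * (r y / q y - 1)" using pos(1)[of y] by simp
    then show ?thesis using pos[of y] by (simp add: kl_def ln_div algebra_simps)
  qed
  have "(\<integral>\<^sup>+y. ennreal (- kl y) \<partial>lborel) \<le> (\<integral>\<^sup>+y. ennreal (r y) \<partial>lborel)"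
    using ge pos by (intro nn_integral_mono ennreal_leI) (smt (verit))
  then show fin: "(\<integral>\<^sup>+y. ennreal (- kl y) \<partial>lborel) \<noteq> \<infinity>" by (auto simp: one top_unique)
  have "ennreal (- kl y) + ennreal (q y) \<le> ennreal (kl y) + ennreal (r y)" for y
  proof -
    have "max 0 (- kl y) + q y \<le> max 0 (kl y) + r y" using ge[of y] by auto
    then have "ennreal (max 0 (- kl y) + q y) \<le> ennreal (max 0 (kl y) + r y)" by (rule ennreal_leI)
    then show ?thesis using pos[of y] by (simp add: ennreal_max_0)
  qed
  then have "(\<integral>\<^sup>+y. ennreal (- kl y) + ennreal (q y) \<partial>lborel) \<le> (\<integral>\<^sup>+y. ennreal (kl y) + ennreal (r y) \<partial>lborel)"
    by (rule nn_integral_mono)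
  then show "(\<integral>\<^sup>+y. ennreal (- kl y) \<partial>lborel) \<le> (\<integral>\<^sup>+y. ennreal (kl y) \<partial>lborel)"
    by (simp add: nn_integral_add one add.commute[of _ 1] ennreal_add_left_cancel_le)
qed

text \<open>
  By Gibbs' inequality the truncated subtraction of \<^typ>\<open>ennreal\<close> loses nothing here.
\<close>
definition kl_divergence :: "('a::euclidean_space \<Rightarrow> real) \<Rightarrow> ('a \<Rightarrow> real) \<Rightarrow> ennreal" where
  "kl_divergence q r = (\<integral>\<^sup>+y. ennreal (q y * ln (q y / r y)) \<partial>lborel)
    - (\<integral>\<^sup>+y. ennreal (- (q y * ln (q y / r y))) \<partial>lborel)"

text \<open>
  The second equation is the decomposition of the divergence into cross entropy and entropy.  Written
  as a sum it also holds if the entropy of \<open>q\<close> is infinite.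
\<close>
lemma kl_divergence_eq:
  fixes q r :: "'a::euclidean_space \<Rightarrow> real"
  assumes [measurable]: "q \<in> borel_measurable borel" "r \<in> borel_measurable borel"
    and pos: "\<And>y. 0 < q y" "\<And>y. 0 < r y"
    and one: "(\<integral>\<^sup>+y. ennreal (q y) \<partial>lborel) = 1" "(\<integral>\<^sup>+y. ennreal (r y) \<partial>lborel) = 1"
    and le: "\<And>y. q y \<le> C" "\<And>y. r y \<le> C"
  shows "ext_integral lborel (\<lambda>y. ereal (q y * ln (q y / r y))) = enn2ereal (kl_divergence q r)"
    and "kl_divergence q r + scaled_entropy q C
      = (\<integral>\<^sup>+y. ennreal (q y * ln (C / r y)) \<partial>lborel)"
proof -
  define kl where "kl y = q y * ln (q y / r y)" for y
  have [measurable]: "kl \<in> borel_measurable borel" unfolding kl_def by measurable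
  define P where "P = (\<integral>\<^sup>+y. ennreal (kl y) \<partial>lborel)"
  define N where "N = (\<integral>\<^sup>+y. ennreal (- kl y) \<partial>lborel)"
  have D: "kl_divergence q r = P - N" by (simp add: kl_divergence_def P_def N_def kl_def)
  have N: "N \<noteq> \<infinity>" "N \<le> P"
    unfolding P_def N_def kl_def by (rule gibbs_inequality; fact)+
  have "enn2ereal P - enn2ereal N = enn2ereal (P - N)"
    using N by (cases P; cases N) (auto simp: ennreal_minus enn2ereal_ennreal top_unique)
  then show "ext_integral lborel (\<lambda>y. ereal (q y * ln (q y / r y))) = enn2ereal (kl_divergence q r)"
    by (simp add: ext_integral_ereal D) (simp add: P_def N_def kl_def)
  define A where "A = scaled_entropy q C"
  define B where "B = (\<integral>\<^sup>+y. ennreal (q y * ln (C / r y)) \<partial>lborel)"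
  have C: "0 < C" using pos(1)[of 0] le(1)[of 0] by linarith
  have pointwise: "ennreal (kl y) + ennreal (q y * ln (C / q y)) = ennreal (- kl y) + ennreal (q y * ln (C / r y))" for y
  proof -
    have "kl y = q y * ln (C / r y) - q y * ln (C / q y)"
      using C pos[of y] by (simp add: kl_def ln_div algebra_simps)
    then have "max 0 (kl y) + q y * ln (C / q y) = max 0 (- kl y) + q y * ln (C / r y)"
      by auto
    moreover have "0 \<le> q y * ln (C / q y)" "0 \<le> q y * ln (C / r y)"
      using pos[of y] le[of y] by simp_all
    ultimately have "ennreal (max 0 (kl y)) + ennreal (q y * ln (C / q y)) =
        ennreal (max 0 (- kl y)) + ennreal (q y * ln (C / r y))"
      by (simp add: ennreal_plus[symmetric] del: ennreal_plus ennreal_max_0)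
    then show ?thesis by (simp add: ennreal_max_0)
  qed
  have "P + A = (\<integral>\<^sup>+y. ennreal (kl y) + ennreal (q y * ln (C / q y)) \<partial>lborel)"
    by (simp add: P_def A_def scaled_entropy_def nn_integral_add)
  also have "\<dots> = N + B"
    unfolding pointwise by (simp add: N_def B_def nn_integral_add)
  finally have "N + ((P - N) + A) = N + B"
    using N(2) by (metis add.assoc add.commute ennreal_minus_cancel_iff diff_add_cancel_ennreal)
  then have "(P - N) + A = B" using N(1) by (simp add: ennreal_add_left_cancel)
  then show "kl_divergence q r + scaled_entropy q C
      = (\<integral>\<^sup>+y. ennreal (q y * ln (C / r y)) \<partial>lborel)"
    by (simp add: D A_def B_def)
qed

section \<open>Predictive densities in location families\<close>

text \<open>
  Average the decomposition of the divergence over \<open>x\<close>.  The entropy of the model density depends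
  neither on \<open>x\<close> nor, by translation invariance, on \<open>\<theta>\<close>.  The average turns the cross entropy into
  the integral of \<open>ln (C / G)\<close> against the density of \<open>Y - X\<close>, which is \<open>G\<close> itself.
\<close>
lemma KL_risk_location_family:
  fixes P Q G :: "real ^ 'n \<Rightarrow> real"
  assumes [measurable]: "P \<in> borel_measurable borel" "Q \<in> borel_measurable borel" "G \<in> borel_measurable borel"
    and pos: "\<And>t. 0 < P t" "\<And>t. 0 < Q t" "\<And>t. 0 < G t"
    and le: "\<And>t. Q t \<le> C" "\<And>t. G t \<le> C"
    and one: "(\<integral>\<^sup>+t. ennreal (P t) \<partial>lborel) = 1" "(\<integral>\<^sup>+t. ennreal (Q t) \<partial>lborel) = 1"
      "(\<integral>\<^sup>+t. ennreal (G t) \<partial>lborel) = 1"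
    and conv: "\<And>z. (\<integral>\<^sup>+u. ennreal (Q (z - u)) * ennreal (P (- u)) \<partial>lborel) = ennreal (G z)"
    and fin: "\<not> (diff_entropy G = \<infinity> \<and> diff_entropy Q = \<infinity>)"
  shows "KL_risk (\<lambda>\<theta> x. P (x - \<theta>)) (\<lambda>\<theta> y. Q (y - \<theta>)) \<theta> (\<lambda>y x. G (y - x)) =
    diff_entropy G - diff_entropy Q"
proof -
  have C: "0 < C" using pos(2)[of 0] le(1)[of 0] by linarith
  define \<alpha> where "\<alpha> = scaled_entropy Q C"
  define \<psi> where "\<psi> z = ennreal (ln (C / G z))" for z
  have [measurable]: "\<psi> \<in> borel_measurable borel" unfolding \<psi>_def by measurable
  let ?q = "\<lambda>y. Q (y - \<theta>)" and ?g = "\<lambda>x y. G (y - x)"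
  define D where "D x = kl_divergence ?q (?g x)" for x
  have shift: "(\<integral>\<^sup>+y. f (y - c) \<partial>lborel) = (\<integral>\<^sup>+y. f y \<partial>lborel)"
    if "f \<in> borel_measurable borel" for f :: "real ^ 'n \<Rightarrow> ennreal" and c
    using nn_integral_lborel_translate[OF that, of "- c"] by simp
  have one': "(\<integral>\<^sup>+y. ennreal (?q y) \<partial>lborel) = 1" "(\<integral>\<^sup>+y. ennreal (?g x y) \<partial>lborel) = 1"
    "(\<integral>\<^sup>+y. ennreal (P (y - \<theta>)) \<partial>lborel) = 1" for x
    using shift[of "\<lambda>y. ennreal (Q y)"] shift[of "\<lambda>y. ennreal (G y)"] shift[of "\<lambda>y. ennreal (P y)"]
    by (simp_all add: one)
  note KL = kl_divergence_eq[of ?q "?g x" C for x, OF _ _ pos(2) pos(3) one'(1,2) le]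
  have D_ext: "ext_integral lborel (\<lambda>y. ereal (?q y * ln (?q y / ?g x y))) = enn2ereal (D x)" for x
    unfolding D_def by (rule KL) measurable
  have D_eq: "D x + \<alpha> = (\<integral>\<^sup>+y. ennreal (?q y) * \<psi> (y - x) \<partial>lborel)" for x
  proof -
    have "\<alpha> = scaled_entropy ?q C"
      unfolding \<alpha>_def scaled_entropy_def
      by (rule shift[of "\<lambda>y. ennreal (Q y * ln (C / Q y))", symmetric]) measurable
    then have "D x + \<alpha> = (\<integral>\<^sup>+y. ennreal (?q y * ln (C / ?g x y)) \<partial>lborel)"
      unfolding D_def by (simp only:) (rule KL, measurable)
    also have "\<dots> = (\<integral>\<^sup>+y. ennreal (?q y) * \<psi> (y - x) \<partial>lborel)"
      using pos(2) by (simp add: \<psi>_def ennreal_mult' less_imp_le)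
    finally show ?thesis .
  qed
  have [measurable]: "D \<in> borel_measurable borel"
    unfolding D_def kl_divergence_def by measurable
  define R where "R = (\<integral>\<^sup>+x. D x * ennreal (P (x - \<theta>)) \<partial>lborel)"
  have risk: "KL_risk (\<lambda>\<theta> x. P (x - \<theta>)) (\<lambda>\<theta> y. Q (y - \<theta>)) \<theta> (\<lambda>y x. G (y - x)) = enn2ereal R"
  proof -
    have "enn2ereal (D x) * ereal (P (x - \<theta>)) = enn2ereal (D x * ennreal (P (x - \<theta>)))" for x
      using pos(1)[of "x - \<theta>"] by (simp add: times_ennreal.rep_eq enn2ereal_ennreal)
    then show ?thesis
      by (simp add: KL_risk_def D_ext R_def ext_integral_enn2ereal)
  qed
  have translate: "(\<integral>\<^sup>+y. ennreal (?q y) * \<psi> (y - x) \<partial>lborel) =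
      (\<integral>\<^sup>+z. ennreal (Q (x + z - \<theta>)) * \<psi> z \<partial>lborel)" for x
    using nn_integral_lborel_translate[of "\<lambda>y. ennreal (?q y) * \<psi> (y - x)" x] by simp
  have "R + \<alpha> = (\<integral>\<^sup>+x. D x * ennreal (P (x - \<theta>)) \<partial>lborel) + (\<integral>\<^sup>+x. \<alpha> * ennreal (P (x - \<theta>)) \<partial>lborel)"
    by (simp add: R_def nn_integral_cmult one')
  also have "\<dots> = (\<integral>\<^sup>+x. D x * ennreal (P (x - \<theta>)) + \<alpha> * ennreal (P (x - \<theta>)) \<partial>lborel)"
    by (rule nn_integral_add[symmetric]) measurable
  also have "\<dots> = (\<integral>\<^sup>+x. (\<integral>\<^sup>+y. ennreal (?q y) * \<psi> (y - x) \<partial>lborel) * ennreal (P (x - \<theta>)) \<partial>lborel)"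
    by (simp add: D_eq distrib_right[symmetric])
  also have "\<dots> = (\<integral>\<^sup>+x. (\<integral>\<^sup>+z. ennreal (Q (x + z - \<theta>)) * \<psi> z \<partial>lborel) * ennreal (P (x - \<theta>)) \<partial>lborel)"
    by (simp only: translate)
  also have "\<dots> = (\<integral>\<^sup>+x. (\<integral>\<^sup>+z. ennreal (Q (x + z - \<theta>)) * \<psi> z * ennreal (P (x - \<theta>)) \<partial>lborel) \<partial>lborel)"
    by (intro nn_integral_cong nn_integral_multc[symmetric]) measurable
  also have "\<dots> = (\<integral>\<^sup>+z. (\<integral>\<^sup>+x. ennreal (Q (x + z - \<theta>)) * \<psi> z * ennreal (P (x - \<theta>)) \<partial>lborel) \<partial>lborel)"
    by (rule lborel_pair.Fubini') measurable
  also have "\<dots> = (\<integral>\<^sup>+z. ennreal (G z) * \<psi> z \<partial>lborel)"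
  proof (rule nn_integral_cong)
    fix z
    have "(\<integral>\<^sup>+x. ennreal (Q (x + z - \<theta>)) * \<psi> z * ennreal (P (x - \<theta>)) \<partial>lborel)
        = (\<integral>\<^sup>+x. ennreal (Q (x + z - \<theta>)) * ennreal (P (x - \<theta>)) * \<psi> z \<partial>lborel)"
      by (simp add: ac_simps)
    also have "\<dots> = (\<integral>\<^sup>+x. ennreal (Q (x + z - \<theta>)) * ennreal (P (x - \<theta>)) \<partial>lborel) * \<psi> z"
      by (rule nn_integral_multc) measurable
    also have "(\<integral>\<^sup>+x. ennreal (Q (x + z - \<theta>)) * ennreal (P (x - \<theta>)) \<partial>lborel)
        = (\<integral>\<^sup>+u. ennreal (Q (z - u)) * ennreal (P (- u)) \<partial>lborel)"
      using nn_integral_lborel_reflect[of "\<lambda>x. ennreal (Q (x + z - \<theta>)) * ennreal (P (x - \<theta>))" \<theta>] by simp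
    finally show "(\<integral>\<^sup>+x. ennreal (Q (x + z - \<theta>)) * \<psi> z * ennreal (P (x - \<theta>)) \<partial>lborel) = ennreal (G z) * \<psi> z"
      by (simp only: conv)
  qed
  also have "\<dots> = scaled_entropy G C"
    using pos(3) by (simp add: scaled_entropy_def \<psi>_def ennreal_mult' less_imp_le)
  finally have R: "R + \<alpha> = scaled_entropy G C" .
  have HQ: "diff_entropy Q = enn2ereal \<alpha> - ereal (ln C)"
    unfolding \<alpha>_def by (rule diff_entropy_bounded_density[OF _ pos(2) le(1) one(2)]) measurable
  have HG: "diff_entropy G = enn2ereal (R + \<alpha>) - ereal (ln C)"
    unfolding R by (rule diff_entropy_bounded_density[OF _ pos(3) le(2) one(3)]) measurable
  \<comment> \<open>If \<open>\<alpha>\<close> were infinite, then so would be \<open>R + \<alpha>\<close>, and both entropies.\<close>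
  have "\<alpha> \<noteq> top"
    using fin unfolding HQ HG by auto
  then show ?thesis
    unfolding risk HQ HG
    by (cases R; cases \<alpha>) (auto simp: enn2ereal_ennreal simp flip: ennreal_plus)
qed

text \<open>
  The posterior under the uniform prior has the density \<open>P (x - \<theta>)\<close> in \<open>\<theta>\<close>, which is already
  normalised; averaging \<open>Q (y - \<theta>)\<close> over it is the convolution \<open>G\<close>.
\<close>
lemma mre_predictive_location_family:
  fixes P Q G :: "real ^ 'n \<Rightarrow> real"
  assumes [measurable]: "P \<in> borel_measurable borel" "Q \<in> borel_measurable borel"
    and nonneg: "\<And>t. 0 \<le> P t" "\<And>t. 0 \<le> Q t" "\<And>t. 0 \<le> G t"
    and one: "(\<integral>\<^sup>+t. ennreal (P t) \<partial>lborel) = 1"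
    and conv: "\<And>z. (\<integral>\<^sup>+u. ennreal (Q (z - u)) * ennreal (P (- u)) \<partial>lborel) = ennreal (G z)"
  shows "mre_predictive (\<lambda>\<theta> x. P (x - \<theta>)) (\<lambda>\<theta> y. Q (y - \<theta>)) y x = G (y - x)"
proof -
  have "(\<integral>\<theta>. P (x - \<theta>) \<partial>lborel) = enn2real (\<integral>\<^sup>+\<theta>. ennreal (P (x - \<theta>)) \<partial>lborel)"
    by (intro integral_eq_nn_integral) (auto simp: nonneg)
  also have "\<dots> = 1"
    using nn_integral_lborel_reflect[of "\<lambda>t. ennreal (P t)" x] by (simp add: one)
  finally have denom: "(\<integral>\<theta>. P (x - \<theta>) \<partial>lborel) = 1" .
  have "(\<integral>\<theta>. Q (y - \<theta>) * P (x - \<theta>) \<partial>lborel) =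
      enn2real (\<integral>\<^sup>+\<theta>. ennreal (Q (y - \<theta>)) * ennreal (P (x - \<theta>)) \<partial>lborel)"
    by (subst integral_eq_nn_integral) (auto simp: nonneg ennreal_mult)
  also have "(\<integral>\<^sup>+\<theta>. ennreal (Q (y - \<theta>)) * ennreal (P (x - \<theta>)) \<partial>lborel) = ennreal (G (y - x))"
    using nn_integral_lborel_translate[of "\<lambda>\<theta>. ennreal (Q (y - \<theta>)) * ennreal (P (x - \<theta>))" x]
      conv[of "y - x"] by (simp add: diff_diff_eq)
  finally show ?thesis
    by (simp add: mre_predictive_def bayes_predictive_def denom nonneg)
qed

section \<open>Reduction of the entropy to the univariate case\<close>

text \<open>
  Additivity of the entropy over independent coordinates.  The logarithm of the product is a sum, and
  in the summand for coordinate \<open>m\<close> all other coordinates integrate to \<open>1\<close>.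
\<close>
lemma scaled_entropy_prod:
  fixes g :: "'n::finite \<Rightarrow> real \<Rightarrow> real"
  assumes [measurable]: "\<And>i. g i \<in> borel_measurable borel"
    and pos: "\<And>i s. 0 < g i s" and le: "\<And>i s. g i s \<le> \<kappa>"
    and one: "\<And>i. (\<integral>\<^sup>+s. ennreal (g i s) \<partial>lborel) = 1"
  shows "scaled_entropy (\<lambda>z :: real ^ 'n. \<Prod>i\<in>UNIV. g i (z $ i)) (\<kappa> ^ CARD('n)) =
    (\<Sum>m\<in>UNIV. scaled_entropy (g m) \<kappa>)"
proof -
  have \<kappa>: "0 < \<kappa>" using pos[of undefined 0] le[of undefined 0] by linarith
  define h where "h m i s = g i s * (if i = m then ln (\<kappa> / g i s) else 1)" for m i s
  have [measurable]: "h m i \<in> borel_measurable borel" for m i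
    unfolding h_def by measurable
  have h_nonneg: "0 \<le> h m i s" for m i s
    using pos[of i s] le[of i s] by (auto simp: h_def intro!: mult_nonneg_nonneg ln_ge_zero)
  have split: "(\<Prod>i\<in>UNIV. g i (z $ i)) * ln (\<kappa> ^ CARD('n) / (\<Prod>i\<in>UNIV. g i (z $ i)))
      = (\<Sum>m\<in>UNIV. \<Prod>i\<in>UNIV. h m i (z $ i))" for z :: "real ^ 'n"
  proof -
    have "ln (\<kappa> ^ CARD('n) / (\<Prod>i\<in>UNIV. g i (z $ i))) = ln (\<Prod>i\<in>UNIV. \<kappa> / g i (z $ i))"
      by (simp add: prod_dividef)
    also have "\<dots> = (\<Sum>m\<in>UNIV. ln (\<kappa> / g m (z $ m)))"
      using \<kappa> pos by (intro ln_prod) (auto simp: less_imp_neq[symmetric])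
    finally show ?thesis
      by (simp add: h_def prod.distrib sum_distrib_left)
  qed
  have int_h: "(\<integral>\<^sup>+s. ennreal (h m i s) \<partial>lborel) =
      (if i = m then scaled_entropy (g m) \<kappa> else 1)" for m i
    by (simp add: h_def one scaled_entropy_def)
  have "scaled_entropy (\<lambda>z :: real ^ 'n. \<Prod>i\<in>UNIV. g i (z $ i)) (\<kappa> ^ CARD('n)) =
      (\<integral>\<^sup>+z. (\<Sum>m\<in>UNIV. \<Prod>i\<in>UNIV. ennreal (h m i ((z :: real ^ 'n) $ i))) \<partial>lborel)"
    unfolding scaled_entropy_def split
    by (simp add: h_nonneg prod_ennreal sum_ennreal prod_nonneg)
  also have "\<dots> = (\<Sum>m\<in>UNIV. \<integral>\<^sup>+z. (\<Prod>i\<in>UNIV. ennreal (h m i ((z :: real ^ 'n) $ i))) \<partial>lborel)"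
    by (rule nn_integral_sum) measurable
  also have "\<dots> = (\<Sum>m\<in>UNIV. \<Prod>i\<in>UNIV. \<integral>\<^sup>+s. ennreal (h m i s) \<partial>lborel)"
    by (intro sum.cong refl nn_integral_prod_components) measurable
  finally show ?thesis
    by (simp add: int_h)
qed

lemma std_normal_density_bounds:
  "0 < std_normal_density s" "std_normal_density s \<le> 1 / sqrt (2 * pi)"
  by (simp_all add: std_normal_density_def divide_right_mono)

text \<open>
  The integrand is the density times \<open>s\<^sup>2 / 2\<close>, so the value is half the variance.
\<close>
lemma std_normal_scaled_entropy:
  "scaled_entropy std_normal_density (1 / sqrt (2 * pi)) = ennreal (1 / 2)"
proof -
  have "1 / sqrt (2 * pi) / std_normal_density s = exp (s\<^sup>2 / 2)" for s :: real
    by (simp add: std_normal_density_def exp_minus inverse_eq_divide)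
  then have ln: "ln (1 / sqrt (2 * pi) / std_normal_density s) = s\<^sup>2 / 2" for s :: real
    by simp
  have "has_bochner_integral lborel (\<lambda>s. std_normal_density s * s\<^sup>2) (1 :: real)"
    using std_normal_moment_even[of 1] by simp
  then have "has_bochner_integral lborel (\<lambda>s. std_normal_density s * s\<^sup>2 / 2) (1 / 2 :: real)"
    by (rule has_bochner_integral_divide_zero)
  then show ?thesis
    unfolding scaled_entropy_def ln
    by (subst nn_integral_eq_integral) (auto simp: has_bochner_integral_iff)
qed

text \<open>
  The density of \<open>MMN\<^sub>1(0, c, 1, L)\<close> for \<open>L\<close> the cdf of \<open>N\<close>, as a function on the real line and not
  on \<open>real ^ 1\<close>.
\<close>
definition normal_mixture :: "real \<Rightarrow> real measure \<Rightarrow> real \<Rightarrow> real" where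
  "normal_mixture c N s = (\<integral>v. std_normal_density (s - v * c) \<partial>N)"

lemma normal_mixture_density:
  assumes N: "real_distribution N"
  shows "integrable N (\<lambda>v. std_normal_density (s - v * c))"
    and "0 < normal_mixture c N s" and "normal_mixture c N s \<le> 1 / sqrt (2 * pi)"
    and "normal_mixture c N \<in> borel_measurable borel"
    and "(\<integral>\<^sup>+s. ennreal (normal_mixture c N s) \<partial>lborel) = 1"
proof -
  interpret real_distribution N by fact
  interpret P: pair_sigma_finite N lborel ..
  show int: "integrable N (\<lambda>v. std_normal_density (s - v * c))" for s
    using std_normal_density_bounds
    by (intro integrable_const_bound[where B = "1 / sqrt (2 * pi)"]) auto
  show "0 < normal_mixture c N s"
    unfolding normal_mixture_def
    using std_normal_density_bounds by (intro expectation_greater int) simp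
  show "normal_mixture c N s \<le> 1 / sqrt (2 * pi)"
    unfolding normal_mixture_def
    using std_normal_density_bounds by (intro integral_le_const int) simp
  have [measurable]: "(\<lambda>(s, v). std_normal_density (s - v * c)) \<in> borel_measurable (borel \<Otimes>\<^sub>M N)"
    by measurable
  show "normal_mixture c N \<in> borel_measurable borel"
    unfolding normal_mixture_def[abs_def] by measurable
  have "(\<integral>\<^sup>+s. ennreal (normal_mixture c N s) \<partial>lborel) =
      (\<integral>\<^sup>+s. (\<integral>\<^sup>+v. ennreal (std_normal_density (s - v * c)) \<partial>N) \<partial>lborel)"
    unfolding normal_mixture_def
    using std_normal_density_bounds(1)[THEN less_imp_le]
    by (intro nn_integral_cong nn_integral_eq_integral[symmetric] int) auto
  also have "\<dots> = (\<integral>\<^sup>+v. (\<integral>\<^sup>+s. ennreal (std_normal_density (s - v * c)) \<partial>lborel) \<partial>N)"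
    by (rule P.Fubini') measurable
  also have "\<dots> = 1"
    by (simp add: nn_integral_std_normal_density_shift emeasure_space_1[simplified])
  finally show "(\<integral>\<^sup>+s. ennreal (normal_mixture c N s) \<partial>lborel) = 1" .
qed

lemma mmn_density_whitened:
  fixes \<Sigma> B :: "real ^ 'n ^ 'n"
  assumes N: "real_distribution N" and \<Sigma>: "pos_def_matrix \<Sigma>"
    and B: "\<And>x. (B *v x) \<bullet> (matrix_inv \<Sigma> *v (B *v x)) = x \<bullet> x" "B *v axis k c = a"
  shows "mmn_density 0 a \<Sigma> (cdf N) (B *v z) =
    (\<Prod>i\<in>UNIV. (if i = k then normal_mixture c N else std_normal_density) (z $ i)) / sqrt (det \<Sigma>)"
proof -
  define r where "r = (\<Prod>i\<in>UNIV - {k}. std_normal_density (z $ i))"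
  have prod: "(\<Prod>i\<in>UNIV. (if i = k then f else std_normal_density) (z $ i)) = f (z $ k) * r" for f
    by (subst prod.remove[of _ k]) (simp_all add: r_def)
  have "mvn_density (0 + v *\<^sub>R a) \<Sigma> (B *v z) = std_normal_density (z $ k - v * c) * (r / sqrt (det \<Sigma>))" for v
  proof -
    have "0 + v *\<^sub>R a = B *v (v *\<^sub>R axis k c)"
      by (simp add: matrix_vector_mult_scaleR B)
    moreover have "(\<Prod>i\<in>UNIV. std_normal_density (z $ i - (v *\<^sub>R axis k c) $ i)) =
        (\<Prod>i\<in>UNIV. (if i = k then (\<lambda>s. std_normal_density (s - v * c)) else std_normal_density) (z $ i))"
      by (intro prod.cong) (auto simp: axis_def)
    ultimately show ?thesis
      by (simp only: mvn_density_whitened[OF \<Sigma> B(1)] prod times_divide_eq_right)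
  qed
  then have "mmn_density 0 a \<Sigma> (cdf N) (B *v z) =
      (\<integral>v. std_normal_density (z $ k - v * c) * (r / sqrt (det \<Sigma>)) \<partial>N)"
    by (simp only: mmn_density_mixture(2)[OF N \<Sigma>])
  also have "\<dots> = normal_mixture c N (z $ k) * (r / sqrt (det \<Sigma>))"
    by (simp add: normal_mixture_def)
  finally show ?thesis by (simp only: prod times_divide_eq_right)
qed

text \<open>
  Whitening produces a product density, whose scaled entropy is that of the mixed coordinate plus one
  half for each of the remaining \<open>CARD('n) - 1\<close> standard normal coordinates.  The Jacobian
  \<open>\<bar>det B\<bar> = sqrt (det \<Sigma>)\<close> and the factors \<open>sqrt (2 * pi)\<close> enter through the bound \<open>C\<close>, the maximal
  value of the normal density.
\<close>
lemma mmn_entropy_normal_mixture: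
  fixes a :: "real ^ 'n" and \<Sigma> :: "real ^ 'n ^ 'n"
  assumes N: "real_distribution N" and \<Sigma>: "pos_def_matrix \<Sigma>" and a: "a \<noteq> 0"
  defines "c \<equiv> sqrt (a \<bullet> (matrix_inv \<Sigma> *v a))"
  shows "mmn_entropy a \<Sigma> (cdf N) =
    enn2ereal (scaled_entropy (normal_mixture c N) (1 / sqrt (2 * pi)))
    + ereal ((real CARD('n) - 1) / 2 + CARD('n) / 2 * ln (2 * pi) + ln (det \<Sigma>) / 2)"
proof -
  define J where "J = scaled_entropy (normal_mixture c N) (1 / sqrt (2 * pi))"
  define \<kappa> where "\<kappa> = 1 / sqrt (2 * pi)"
  define C where "C = 1 / sqrt ((2 * pi) ^ CARD('n) * det \<Sigma>)"
  define k :: 'n where "k = undefined"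
  define g where "g i = (if i = k then normal_mixture c N else std_normal_density)" for i :: 'n
  define F where "F z = (\<Prod>i\<in>UNIV. g i (z $ i))" for z :: "real ^ 'n"
  let ?f = "mmn_density 0 a \<Sigma> (cdf N)"
  note det = pos_def_matrix_det_pos[OF \<Sigma>]
  obtain B :: "real ^ 'n ^ 'n"
    where B: "\<And>x. (B *v x) \<bullet> (matrix_inv \<Sigma> *v (B *v x)) = x \<bullet> x" "B *v axis k c = a"
      and detB: "\<bar>det B\<bar> = sqrt (det \<Sigma>)" "det B \<noteq> 0"
    unfolding c_def by (rule whitening_matrix_exists[OF \<Sigma> a, where k = k]) auto
  have [measurable]: "?f \<in> borel_measurable borel" "(*v) B \<in> borel_measurable borel"
    by (rule borel_measurable_mmn_density[OF N \<Sigma>] borel_measurable_linear[OF matrix_vector_mul_linear])+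
  have fB: "?f (B *v z) = F z / sqrt (det \<Sigma>)" for z
    unfolding F_def g_def by (rule mmn_density_whitened[OF N \<Sigma> B])
  have C: "C = \<kappa> ^ CARD('n) / sqrt (det \<Sigma>)"
    by (simp add: C_def \<kappa>_def real_sqrt_mult real_sqrt_power power_one_over power_mult_distrib)
  have "scaled_entropy ?f C =
      ennreal \<bar>det B\<bar> * (\<integral>\<^sup>+z. ennreal (?f (B *v z) * ln (C / ?f (B *v z))) \<partial>lborel)"
    unfolding scaled_entropy_def by (rule nn_integral_matrix_change[OF detB(2)]) measurable
  also have "\<dots> = (\<integral>\<^sup>+z. ennreal \<bar>det B\<bar> * ennreal (?f (B *v z) * ln (C / ?f (B *v z))) \<partial>lborel)"
    by (rule nn_integral_cmult[symmetric]) measurable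
  also have "\<dots> = scaled_entropy F (\<kappa> ^ CARD('n))"
    unfolding scaled_entropy_def
    using det by (simp add: ennreal_mult'[symmetric] detB fB C)
  also have "\<dots> = (\<Sum>m\<in>UNIV. scaled_entropy (g m) \<kappa>)"
    unfolding F_def
    by (rule scaled_entropy_prod)
      (simp_all add: g_def \<kappa>_def normal_mixture_density[OF N] std_normal_density_bounds nn_integral_std_normal_density)
  also have "\<dots> = (\<Sum>m\<in>UNIV. if m = k then J else ennreal (1 / 2))"
  proof (rule sum.cong[OF refl])
    fix m :: 'n
    show "scaled_entropy (g m) \<kappa> = (if m = k then J else ennreal (1 / 2))"
      by (cases "m = k") (simp_all only: g_def \<kappa>_def J_def std_normal_scaled_entropy refl if_True if_False)
  qed
  also have "\<dots> = J + (\<Sum>m\<in>UNIV - {k}. ennreal (1 / 2))"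
    by (subst sum.remove[of _ k]) (simp_all cong: sum.cong_simp)
  also have "(\<Sum>m\<in>UNIV - {k}. ennreal (1 / 2)) = ennreal (\<Sum>m\<in>UNIV - {k}. 1 / 2)"
    by (rule sum_ennreal) simp
  also have "(\<Sum>m\<in>UNIV - {k}. 1 / 2) = (real CARD('n) - 1) / 2"
    by (simp add: card_Diff_singleton of_nat_diff Suc_le_eq card_gt_0_iff)
  finally have rel: "scaled_entropy ?f C = J + ennreal ((real CARD('n) - 1) / 2)" .
  have "mmn_entropy a \<Sigma> (cdf N) = enn2ereal (scaled_entropy ?f C) - ereal (ln C)"
    unfolding mmn_entropy_def C_def
    by (rule diff_entropy_bounded_density[OF _ mmn_density_pos[OF N \<Sigma>] mmn_density_le[OF N \<Sigma>]
          nn_integral_mmn_density[OF N \<Sigma>]]) measurable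
  also have "\<dots> = enn2ereal J + ereal ((real CARD('n) - 1) / 2 - ln C)"
    unfolding rel by (cases J) (auto simp: enn2ereal_ennreal simp flip: ennreal_plus)
  finally have H: "mmn_entropy a \<Sigma> (cdf N) = enn2ereal J + ereal ((real CARD('n) - 1) / 2 - ln C)" .
  have "ln C = - (CARD('n) / 2 * ln (2 * pi) + ln (det \<Sigma>) / 2)"
    using det by (simp add: C_def ln_div ln_sqrt ln_mult ln_realpow algebra_simps)
  then have "(real CARD('n) - 1) / 2 - ln C =
      (real CARD('n) - 1) / 2 + CARD('n) / 2 * ln (2 * pi) + ln (det \<Sigma>) / 2"
    by simp
  with H show ?thesis by (simp only: J_def)
qed

lemma pos_def_matrix_mat_1: "pos_def_matrix (mat 1 :: real ^ 'n ^ 'n)"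
  by (simp add: pos_def_matrix_def transpose_mat)

lemma matrix_inv_mat_1: "matrix_inv (mat 1 :: real ^ 'n ^ 'n) = mat 1"
  using invertible_matrix_inv(1)[OF pos_def_matrix_invertible[OF pos_def_matrix_mat_1]] by simp

text \<open>
  In dimension one with unit variance, \<open>c\<close> is its own length in the inner product of the previous
  lemma, so exactly the same integral appears.
\<close>
lemma mmn_entropy1_normal_mixture:
  assumes N: "real_distribution N" and c: "0 < c"
  shows "mmn_entropy1 c 1 (cdf N) =
    enn2ereal (scaled_entropy (normal_mixture c N) (1 / sqrt (2 * pi))) + ereal (ln (2 * pi) / 2)"
proof -
  have "sqrt ((vec c :: real ^ 1) \<bullet> (matrix_inv (mat 1) *v vec c)) = c"
    using c by (simp add: matrix_inv_mat_1 inner_vec_def)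
  moreover have "(vec c :: real ^ 1) \<noteq> 0" using c by (simp add: vec_eq_iff)
  ultimately show ?thesis
    using mmn_entropy_normal_mixture[OF N pos_def_matrix_mat_1, of "vec c :: real ^ 1"]
    by (simp add: mmn_entropy1_def)
qed

text \<open>
  The constant depends on \<open>\<Sigma>\<close> only through its determinant and not on the mixing law, so the
  difference of two entropies in the same dimension involves just the univariate entropies and the
  ratio of the determinants.  The second claim makes that difference well-defined as soon as the
  entropies are not both \<open>\<infinity>\<close>.
\<close>
lemma mmn_entropy_reduction:
  fixes a :: "real ^ 'n" and \<Sigma> :: "real ^ 'n ^ 'n"
  assumes N: "real_distribution N" and \<Sigma>: "pos_def_matrix \<Sigma>" and a: "a \<noteq> 0"
  defines "c \<equiv> sqrt (a \<bullet> (matrix_inv \<Sigma> *v a))"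
  shows "mmn_entropy a \<Sigma> (cdf N) = mmn_entropy1 c 1 (cdf N)
      + ereal ((real CARD('n) - 1) / 2 * (1 + ln (2 * pi)) + ln (det \<Sigma>) / 2)"
    and "mmn_entropy1 c 1 (cdf N) \<noteq> - \<infinity>"
proof -
  have "0 < c"
    using pos_def_matrix_inverse[OF \<Sigma>] a by (simp add: c_def pos_def_matrix_def)
  note H1 = mmn_entropy1_normal_mixture[OF N this]
  define J where "J = scaled_entropy (normal_mixture c N) (1 / sqrt (2 * pi))"
  have arith: "(real CARD('n) - 1) / 2 + CARD('n) / 2 * ln (2 * pi) + ln (det \<Sigma>) / 2 =
      ln (2 * pi) / 2 + ((real CARD('n) - 1) / 2 * (1 + ln (2 * pi)) + ln (det \<Sigma>) / 2)"
    by (simp add: field_simps)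
  show "mmn_entropy a \<Sigma> (cdf N) = mmn_entropy1 c 1 (cdf N)
      + ereal ((real CARD('n) - 1) / 2 * (1 + ln (2 * pi)) + ln (det \<Sigma>) / 2)"
    unfolding mmn_entropy_normal_mixture[OF N \<Sigma> a] H1 arith c_def[symmetric]
    by (simp only: add.assoc plus_ereal.simps(1))
  show "mmn_entropy1 c 1 (cdf N) \<noteq> - \<infinity>"
    unfolding H1 J_def[symmetric] by (cases J) (auto simp: enn2ereal_ennreal)
qed

theorem theorem2:
  fixes a \<theta> :: "real ^ 'n"
    and \<Sigma>X \<Sigma>Y \<Sigma>S :: "real ^ 'n ^ 'n"
    and L1 L2 L3 :: "real \<Rightarrow> real"
    and M :: "'w measure" and V1 V2 :: "'w \<Rightarrow> real"
    and p q :: "real ^ 'n \<Rightarrow> real ^ 'n \<Rightarrow> real"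
  assumes "CARD('n) \<ge> 2"
    and "a \<noteq> 0"
    and "pos_def_matrix \<Sigma>X" and "pos_def_matrix \<Sigma>Y"
    and "\<Sigma>S = \<Sigma>X + \<Sigma>Y"
    and "prob_space M"
    and "prob_space.indep_var M borel V1 borel V2"
    and "L1 = cdf (distr M borel V1)"
    and "L2 = cdf (distr M borel V2)"
    and "L3 = cdf (distr M borel (\<lambda>\<omega>. V2 \<omega> - V1 \<omega>))"
    and "p = (\<lambda>\<theta>. mmn_density \<theta> a \<Sigma>X L1)"
    and "q = (\<lambda>\<theta>. mmn_density \<theta> a \<Sigma>Y L2)"
    and not_inf_minus_inf:
      "\<not> (mmn_entropy1 (sqrt (a \<bullet> (matrix_inv \<Sigma>S *v a))) 1 L3 = \<infinity> \<and>
          mmn_entropy1 (sqrt (a \<bullet> (matrix_inv \<Sigma>Y *v a))) 1 L2 = \<infinity>)"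
  shows "KL_risk p q \<theta> (mre_predictive p q) =
      mmn_entropy1 (sqrt (a \<bullet> (matrix_inv \<Sigma>S *v a))) 1 L3
    - mmn_entropy1 (sqrt (a \<bullet> (matrix_inv \<Sigma>Y *v a))) 1 L2
    + ereal (1 / 2 * ln (det \<Sigma>S / det \<Sigma>Y))"
proof -
  interpret prob_space M by fact
  note a = \<open>a \<noteq> 0\<close> and X = \<open>pos_def_matrix \<Sigma>X\<close> and Y = \<open>pos_def_matrix \<Sigma>Y\<close>
  define N1 where "N1 = distr M borel V1"
  define N2 where "N2 = distr M borel V2"
  define N3 where "N3 = distr M borel (\<lambda>\<omega>. V2 \<omega> - V1 \<omega>)"
  have [measurable]: "V1 \<in> borel_measurable M" "V2 \<in> borel_measurable M"
    and product: "N1 \<Otimes>\<^sub>M N2 = distr M (borel \<Otimes>\<^sub>M borel) (\<lambda>\<omega>. (V1 \<omega>, V2 \<omega>))"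
    using \<open>indep_var borel V1 borel V2\<close> by (auto simp: indep_var_distribution_eq N1_def N2_def)
  have N1: "real_distribution N1" and N2: "real_distribution N2" and N3: "real_distribution N3"
    unfolding N1_def N2_def N3_def by (rule real_distribution_distr; measurable)+
  have N3_eq: "distr (N1 \<Otimes>\<^sub>M N2) borel (\<lambda>(v1, v2). v2 - v1) = N3"
    unfolding product by (subst distr_distr) (auto simp: N3_def comp_def)
  have S: "pos_def_matrix \<Sigma>S"
    using pos_def_matrix_add[OF X Y] \<open>\<Sigma>S = \<Sigma>X + \<Sigma>Y\<close> by simp
  have L: "L1 = cdf N1" "L2 = cdf N2" "L3 = cdf N3"
    using assms by (simp_all add: N1_def N2_def N3_def)
  define P where "P = mmn_density 0 a \<Sigma>X L1"
  define Q where "Q = mmn_density 0 a \<Sigma>Y L2"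
  define G where "G = mmn_density 0 a \<Sigma>S L3"
  have p: "p = (\<lambda>\<theta> x. P (x - \<theta>))" and q: "q = (\<lambda>\<theta> y. Q (y - \<theta>))"
    unfolding P_def Q_def \<open>p = _\<close> \<open>q = _\<close> by (intro ext mmn_density_location)+
  have meas: "P \<in> borel_measurable borel" "Q \<in> borel_measurable borel" "G \<in> borel_measurable borel"
    unfolding P_def Q_def G_def L
    by (rule borel_measurable_mmn_density[OF N1 X] borel_measurable_mmn_density[OF N2 Y]
        borel_measurable_mmn_density[OF N3 S])+
  have pos: "0 < P t" "0 < Q t" "0 < G t" for t
    unfolding P_def Q_def G_def L
    by (rule mmn_density_pos[OF N1 X] mmn_density_pos[OF N2 Y] mmn_density_pos[OF N3 S])+
  have one: "(\<integral>\<^sup>+t. ennreal (P t) \<partial>lborel) = 1" "(\<integral>\<^sup>+t. ennreal (Q t) \<partial>lborel) = 1"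
    "(\<integral>\<^sup>+t. ennreal (G t) \<partial>lborel) = 1"
    unfolding P_def Q_def G_def L
    by (rule nn_integral_mmn_density[OF N1 X] nn_integral_mmn_density[OF N2 Y]
        nn_integral_mmn_density[OF N3 S])+
  \<comment> \<open>A common bound of both densities, so that the terms \<open>ln C\<close> cancel in the risk.\<close>
  define C where "C = max (1 / sqrt ((2 * pi) ^ CARD('n) * det \<Sigma>Y)) (1 / sqrt ((2 * pi) ^ CARD('n) * det \<Sigma>S))"
  have le: "Q t \<le> C" "G t \<le> C" for t
    unfolding Q_def G_def L C_def
    by (rule max.coboundedI1[OF mmn_density_le[OF N2 Y]] max.coboundedI2[OF mmn_density_le[OF N3 S]])+
  have conv: "(\<integral>\<^sup>+u. ennreal (Q (z - u)) * ennreal (P (- u)) \<partial>lborel) = ennreal (G z)" for z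
  proof -
    have "mmn_density u a \<Sigma>Y (cdf N2) z = Q (z - u)" "mmn_density u a \<Sigma>X (cdf N1) 0 = P (- u)" for u
      unfolding Q_def P_def L
      using mmn_density_location[of u a \<Sigma>Y "cdf N2" z] mmn_density_location[of u a \<Sigma>X "cdf N1" 0]
      by simp_all
    then show ?thesis
      using nn_integral_mmn_density_convolution[OF N1 N2 X Y, of a z 0]
      by (simp add: N3_eq \<open>\<Sigma>S = \<Sigma>X + \<Sigma>Y\<close> G_def L)
  qed
  have mre: "mre_predictive p q = (\<lambda>y x. G (y - x))"
    unfolding p q
    by (intro ext mre_predictive_location_family meas one conv less_imp_le[OF pos(1)]
        less_imp_le[OF pos(2)] less_imp_le[OF pos(3)])
  let ?k = "(real CARD('n) - 1) / 2 * (1 + ln (2 * pi))"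
  define hS where "hS = mmn_entropy1 (sqrt (a \<bullet> (matrix_inv \<Sigma>S *v a))) 1 L3"
  define hY where "hY = mmn_entropy1 (sqrt (a \<bullet> (matrix_inv \<Sigma>Y *v a))) 1 L2"
  have HG: "diff_entropy G = hS + ereal (?k + ln (det \<Sigma>S) / 2)" "hS \<noteq> - \<infinity>"
    using mmn_entropy_reduction[OF N3 S a] by (simp_all add: hS_def G_def L mmn_entropy_def)
  have HQ: "diff_entropy Q = hY + ereal (?k + ln (det \<Sigma>Y) / 2)" "hY \<noteq> - \<infinity>"
    using mmn_entropy_reduction[OF N2 Y a] by (simp_all add: hY_def Q_def L mmn_entropy_def)
  have fin: "\<not> (hS = \<infinity> \<and> hY = \<infinity>)" using not_inf_minus_inf by (simp add: hS_def hY_def)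
  have "KL_risk p q \<theta> (mre_predictive p q) = diff_entropy G - diff_entropy Q"
    unfolding mre unfolding p q
    by (rule KL_risk_location_family[OF meas pos le one conv])
      (use fin in \<open>auto simp: HG HQ\<close>)
  also have "\<dots> = hS - hY + ereal (1 / 2 * ln (det \<Sigma>S / det \<Sigma>Y))"
    unfolding HG HQ
    using fin HG(2) HQ(2) pos_def_matrix_det_pos[OF S] pos_def_matrix_det_pos[OF Y]
    by (cases hS; cases hY) (auto simp: ln_div field_simps)
  finally show ?thesis by (simp only: hS_def hY_def)
qed

end
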